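(* Let $E$ and $F$ be two nonzero Banach lattices. Then the following statements are equivalent: (1) Every positive semi-compact operator $T:E\rightarrow F$ is almost M-weakly compact; (2) The norm of the dual $E'$ is order continuous.
   Context: All Banach spaces and Banach lattices are real, and operators are continuous linear maps. $B_E$ denotes the closed unit ball of $E$, $E_+$ the positive cone of $E$, and $E'$ the norm dual of $E$ (a Banach lattice). An operator $T:E\to F$ is semi-compact if for each $\varepsilon>0$ there exists $u\in F_+$ such that $T(B_E)\subset[-u,u]+\varepsilon B_F$. An operator $T$ from a Banach lattice $E$ into a Banach space $Y$ is almost M-weakly compact if for every disjoint sequence $(x_n)$ in $B_E$ and every weakly convergent sequence $(f_n)$ of $Y'$ one has $f_n(T(x_n))\to 0$. The norm of a Banach lattice $G$ is order continuous if $\|x_\alpha\|\downarrow 0$ for every net $(x_\alpha)$ in $G$ with $x_\alpha\downarrow 0$. *)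

theory Defs
  imports "HOL-Analysis.Analysis" "HOL-Library.Lattice_Algebras"
begin

class banach_lattice = banach + ordered_real_vector + lattice_ab_group_add_abs +
  assumes norm_mono_abs: "\<bar>x\<bar> \<le> \<bar>y\<bar> \<Longrightarrow> norm x \<le> norm y"

instance real :: banach_lattice
  by standard auto

(* The usual order on operators: S \<le> T iff T - S is positive.  In particular 0 \<le> T says that T is
   a positive operator, and for codomain real this is the order of the Banach lattice dual. *)
instantiation blinfun :: (banach_lattice, banach_lattice) ordered_real_vector
begin

definition less_eq_blinfun :: "('a \<Rightarrow>\<^sub>L 'b) \<Rightarrow> ('a \<Rightarrow>\<^sub>L 'b) \<Rightarrow> bool" where
  "less_eq_blinfun S T \<longleftrightarrow> (\<forall>x\<ge>0. blinfun_apply S x \<le> blinfun_apply T x)"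

definition less_blinfun :: "('a \<Rightarrow>\<^sub>L 'b) \<Rightarrow> ('a \<Rightarrow>\<^sub>L 'b) \<Rightarrow> bool" where
  "less_blinfun S T \<longleftrightarrow> S \<le> T \<and> \<not> T \<le> S"

instance
proof
  fix R S T :: "'a \<Rightarrow>\<^sub>L 'b" and a b :: real
  show "S < T \<longleftrightarrow> S \<le> T \<and> \<not> T \<le> S"
    by (rule less_blinfun_def)
  show "S \<le> S"
    by (simp add: less_eq_blinfun_def)
  show "R \<le> T" if "R \<le> S" "S \<le> T"
    using that by (meson less_eq_blinfun_def order_trans)
  show "S = T" if "S \<le> T" "T \<le> S"
  proof (rule blinfun_eqI)
    fix x :: 'a
    have eq: "S z = T z" if "0 \<le> z" for z
      using \<open>S \<le> T\<close> \<open>T \<le> S\<close> that by (simp add: less_eq_blinfun_def antisym)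
    have "0 \<le> sup x 0" and "0 \<le> sup x 0 - x"
      by simp_all
    from eq[OF this(1)] eq[OF this(2)] show "S x = T x"
      by (simp add: blinfun.diff_right)
  qed
  show "R + S \<le> R + T" if "S \<le> T"
    using that by (simp add: less_eq_blinfun_def blinfun.add_left)
  show "a *\<^sub>R S \<le> a *\<^sub>R T" if "S \<le> T" "0 \<le> a"
    using that by (simp add: less_eq_blinfun_def blinfun.scaleR_left scaleR_left_mono)
  show "a *\<^sub>R S \<le> b *\<^sub>R S" if "a \<le> b" "0 \<le> S"
    using that by (simp add: less_eq_blinfun_def blinfun.scaleR_left scaleR_right_mono)
qed

end

definition semi_compact :: "('a::real_normed_vector \<Rightarrow>\<^sub>L 'b::banach_lattice) \<Rightarrow> bool" where
  "semi_compact T \<longleftrightarrow>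
    (\<forall>\<epsilon>>0. \<exists>u\<ge>0. blinfun_apply T ` cball 0 1 \<subseteq> {v + \<epsilon> *\<^sub>R w | v w. v \<in> {-u..u} \<and> w \<in> cball 0 1})"

definition disjoint_seq :: "(nat \<Rightarrow> 'a::banach_lattice) \<Rightarrow> bool" where
  "disjoint_seq x \<longleftrightarrow> (\<forall>m n. m \<noteq> n \<longrightarrow> inf \<bar>x m\<bar> \<bar>x n\<bar> = 0)"

definition weakly_convergent :: "(nat \<Rightarrow> 'a::real_normed_vector) \<Rightarrow> bool" where
  "weakly_convergent f \<longleftrightarrow>
    (\<exists>l. \<forall>\<phi> :: 'a \<Rightarrow>\<^sub>L real. (\<lambda>n. blinfun_apply \<phi> (f n)) \<longlonglongrightarrow> blinfun_apply \<phi> l)"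

definition almost_M_weakly_compact :: "('a::banach_lattice \<Rightarrow>\<^sub>L 'y::banach) \<Rightarrow> bool" where
  "almost_M_weakly_compact T \<longleftrightarrow>
    (\<forall>(x :: nat \<Rightarrow> 'a) (f :: nat \<Rightarrow> 'y \<Rightarrow>\<^sub>L real).
      disjoint_seq x \<longrightarrow> range x \<subseteq> cball 0 1 \<longrightarrow> weakly_convergent f \<longrightarrow>
      (\<lambda>n. blinfun_apply (f n) (blinfun_apply T (x n))) \<longlonglongrightarrow> 0)"

definition directed_set :: "'i set \<Rightarrow> 'i rel \<Rightarrow> bool" where
  "directed_set I r \<longleftrightarrow>
    I \<noteq> {} \<and> preorder_on I r \<and> (\<forall>i\<in>I. \<forall>j\<in>I. \<exists>k\<in>I. (i, k) \<in> r \<and> (j, k) \<in> r)"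

definition decreases_to_zero :: "'i set \<Rightarrow> 'i rel \<Rightarrow> ('i \<Rightarrow> 'a::{order, zero}) \<Rightarrow> bool" where
  "decreases_to_zero I r x \<longleftrightarrow>
    (\<forall>(i, j)\<in>r. x j \<le> x i) \<and>
    (\<forall>i\<in>I. 0 \<le> x i) \<and> (\<forall>l. (\<forall>i\<in>I. l \<le> x i) \<longrightarrow> l \<le> 0)"

(* HOL cannot quantify over the type of indices inside a definition, so the nets here are indexed by
   directed sets of elements of the space itself.  Nothing is lost: order_continuous_norm_net below
   gives the property for nets over an arbitrary index type. *)
definition order_continuous_norm :: "'a::{order, real_normed_vector} itself \<Rightarrow> bool" where
  "order_continuous_norm _ \<longleftrightarrow>
    (\<forall>(I :: 'a set) r (x :: 'a \<Rightarrow> 'a).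
      directed_set I r \<longrightarrow> decreases_to_zero I r x \<longrightarrow> decreases_to_zero I r (\<lambda>i. norm (x i)))"

lemma order_continuous_norm_net:
  fixes x :: "'i \<Rightarrow> 'a::{order, real_normed_vector}"
  assumes oc: "order_continuous_norm TYPE('a)"
    and dir: "directed_set I r" and dec: "decreases_to_zero I r x"
  shows "decreases_to_zero I r (\<lambda>i. norm (x i))"
proof -
  define s where "s = {(a, b). a \<in> x ` I \<and> b \<in> x ` I \<and> b \<le> a}"
  have r: "r \<subseteq> I \<times> I"
    using dir by (simp add: directed_set_def preorder_on_def)
  have "preorder_on (x ` I) s"
    by (auto simp: preorder_on_def s_def refl_on_def intro!: transI)
  moreover have "\<exists>c\<in>x ` I. (a, c) \<in> s \<and> (b, c) \<in> s" if ab: "a \<in> x ` I" "b \<in> x ` I" for a b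
  proof -
    obtain i j where ij: "i \<in> I" "j \<in> I" "a = x i" "b = x j"
      using ab by blast
    then obtain k where "k \<in> I" "(i, k) \<in> r" "(j, k) \<in> r"
      using dir by (auto simp: directed_set_def)
    with ij dec show ?thesis
      by (intro bexI[of _ "x k"]) (auto simp: s_def decreases_to_zero_def)
  qed
  ultimately have "directed_set (x ` I) s"
    using dir by (simp add: directed_set_def)
  moreover have "decreases_to_zero (x ` I) s (\<lambda>a. a)"
    using dec by (auto simp: decreases_to_zero_def s_def)
  ultimately have *: "decreases_to_zero (x ` I) s (\<lambda>a. norm a)"
    using oc unfolding order_continuous_norm_def by blast
  have "(x i, x j) \<in> s" if "(i, j) \<in> r" for i j
    using that r dec by (auto simp: s_def decreases_to_zero_def)
  with * show ?thesis
    by (fastforce simp: decreases_to_zero_def)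
qed

end

theory Submission
  imports Defs
begin

text \<open>
  Both conditions are compared with a third one: every positive functional on \<open>E\<close> tends to zero
  along every disjoint sequence of positive elements of the unit ball of \<open>E\<close>.

  \<^bold>\<open>From the operators to the dual norm.\<close> A rank-one operator \<open>x \<mapsto> g x *\<^sub>R v\<close> with \<open>g, v \<ge> 0\<close> maps
  the unit ball into an order interval, hence is semi-compact. Testing it against a constant
  sequence of functionals \<open>f\<close> with \<open>f v > 0\<close> gives the third condition for \<open>g\<close>. Such an \<open>f\<close> exists
  by the Hahn-Banach theorem (\<open>norming_functional\<close>). Now let a net of functionals decrease to zero
  while its norms stay above \<open>l > 0\<close>. The net converges to zero pointwise on the positive cone,
  because the pointwise infimum extends to a functional. So one can choose inductively members
  \<open>g n\<close> of the net, all below a fixed \<open>h\<close>, and positive \<open>w n\<close> in the unit ball with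
  \<open>g n (w n) > l / 2\<close> while \<open>g n\<close> nearly vanishes on all the earlier \<open>w i\<close>. Subtracting large
  multiples of the earlier elements makes the \<open>w n\<close> disjoint at almost no cost for \<open>g n\<close>
  (\<open>disjointification\<close>), and \<open>h\<close> stays away from zero along the resulting disjoint sequence
  (\<open>order_continuous_dual_normI\<close>).

  \<^bold>\<open>From the dual norm to the operators.\<close> If the norm of the dual is order continuous, then splitting
  off from \<open>g \<ge> 0\<close> the components carried by the first \<open>n\<close> members of a disjoint sequence leaves
  functionals that decrease to a limit vanishing on all of them. The excess over this limit decreases
  to zero, hence in norm, and this is the third condition
  (\<open>disjoint_null_of_order_continuous_dual\<close>). So it remains to show \<open>f n (T (x n)) \<longlonglongrightarrow> 0\<close> when
  \<open>f n\<close> is weakly null in the dual of \<open>F\<close>, \<open>T\<close> is positive and semi-compact, and the \<open>x n \<ge> 0\<close> are in the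
  unit ball and null for all positive functionals. Semi-compactness puts \<open>T (x n)\<close> in an order
  interval \<open>{0..u}\<close>, up to an error that is harmless because \<open>f\<close> is bounded. In an order interval
  the assertion is a Dunford-Pettis property (\<open>weakly_null_on_order_interval\<close>): along a subsequence,
  the part of \<open>z k = T (x k)\<close> that is not covered by the later \<open>z i\<close> defines an element \<open>\<phi> k\<close> of the
  bidual of \<open>F\<close>, and \<open>f k\<close> hardly distinguishes it from \<open>z k\<close>. These parts add up to at most \<open>u\<close>,
  so that \<open>\<Sum>k. \<bar>\<phi> k h\<bar>\<close> is finite for all functionals \<open>h\<close>, and a gliding hump argument, which is
  Schur's theorem on \<open>\<ell>\<^sub>1\<close> in disguise, yields \<open>\<phi> k (f k) \<longlonglongrightarrow> 0\<close> (\<open>weakly_null_diagonal\<close>).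
\<close>

section \<open>Banach lattices\<close>

lemma norm_abs_eq [simp]: "norm \<bar>x\<bar> = norm (x::'a::banach_lattice)"
  by (simp add: antisym norm_mono_abs)

lemma norm_mono_nonneg:
  fixes x y :: "'a::banach_lattice"
  assumes "0 \<le> x" "x \<le> y"
  shows "norm x \<le> norm y"
  using assms by (intro norm_mono_abs) (simp add: order_trans[OF assms])

lemma pprt_le_abs: "pprt x \<le> \<bar>x\<bar>" for x :: "'a::banach_lattice"
  by (simp add: pprt_def abs_ge_self)

lemma norm_pprt_le: "norm (pprt x) \<le> norm x" for x :: "'a::banach_lattice"
  using norm_mono_nonneg[OF zero_le_pprt pprt_le_abs] by simp

lemma pprt_minus_pprt: "pprt x - pprt (- x) = x" for x :: "'a::banach_lattice"
  using prts[of x] by (simp add: pprt_neg)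

lemma pprt_plus_pprt: "pprt x + pprt (- x) = \<bar>x\<bar>" for x :: "'a::banach_lattice"
  by (simp add: pprt_neg abs_prts)

lemma scaleR_inf:
  fixes x y :: "'a::banach_lattice"
  assumes "0 \<le> c"
  shows "c *\<^sub>R inf x y = inf (c *\<^sub>R x) (c *\<^sub>R y)"
proof (cases "c = 0")
  case False
  with assms have c: "0 < c" by simp
  have "inverse c *\<^sub>R inf (c *\<^sub>R x) (c *\<^sub>R y) \<le> inf x y"
    using c scaleR_left_mono[of "inf (c *\<^sub>R x) (c *\<^sub>R y)" "c *\<^sub>R x" "inverse c"]
      scaleR_left_mono[of "inf (c *\<^sub>R x) (c *\<^sub>R y)" "c *\<^sub>R y" "inverse c"] by simp
  from scaleR_left_mono[OF this assms] have "inf (c *\<^sub>R x) (c *\<^sub>R y) \<le> c *\<^sub>R inf x y"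
    using c by simp
  then show ?thesis
    using assms by (intro antisym) (simp_all add: scaleR_left_mono)
qed simp

lemma pprt_scaleR:
  fixes x :: "'a::banach_lattice"
  assumes "0 \<le> c"
  shows "c *\<^sub>R pprt x = pprt (c *\<^sub>R x)"
proof -
  have "c *\<^sub>R nprt (- x) = nprt (- (c *\<^sub>R x))"
    using scaleR_inf[OF assms, of "- x" 0] by (simp only: nprt_def scaleR_zero_right scaleR_minus_right)
  then show ?thesis
    by (simp add: nprt_neg)
qed

lemma diff_inf_eq_pprt: "x - inf x y = pprt (x - y)" for x :: "'a::banach_lattice"
  by (simp add: pprt_def add_sup_distrib_left sup_commute)

text \<open>Since \<open>pprt (b - a)\<close> is the negative part of \<open>a - b\<close>, subtracting the infimum from the positive
  part leaves \<open>pprt (a - b)\<close>, so the infimum is zero.\<close>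
lemma inf_pprt_diff: "inf (pprt (a - b)) (pprt (b - a)) = 0" for a :: "'a::banach_lattice"
proof -
  have "pprt (a - b) - pprt (b - a) = a - b"
    using pprt_minus_pprt[of "a - b"] by simp
  with diff_inf_eq_pprt[of "pprt (a - b)" "pprt (b - a)"]
  have "pprt (a - b) - inf (pprt (a - b)) (pprt (b - a)) = pprt (a - b)"
    by (simp only:)
  then show ?thesis
    by (metis add_cancel_left_right diff_add_cancel)
qed

lemma inf_add_le:
  fixes a b c :: "'a::banach_lattice"
  assumes "0 \<le> a" "0 \<le> b" "0 \<le> c"
  shows "inf a (b + c) \<le> inf a b + inf a c"
proof -
  have "inf a (b + c) \<le> a + a" "inf a (b + c) \<le> b + a" "inf a (b + c) \<le> a + c"
    using assms by (auto intro: order_trans[OF inf_le1] add_increasing add_increasing2)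
  then show ?thesis
    by (simp add: add_inf_distrib_left add_inf_distrib_right)
qed

lemma disjoint_scaleR:
  fixes a b :: "'a::banach_lattice"
  assumes "0 \<le> a" "0 \<le> b" "inf a b = 0" "0 \<le> c"
  shows "inf a (c *\<^sub>R b) = 0"
proof (rule antisym)
  define d where "d = max 1 c"
  have "a \<le> d *\<^sub>R a" "c *\<^sub>R b \<le> d *\<^sub>R b"
    using assms scaleR_right_mono[of 1 d a] scaleR_right_mono[of c d b] by (auto simp: d_def)
  then have "inf a (c *\<^sub>R b) \<le> inf (d *\<^sub>R a) (d *\<^sub>R b)"
    by (rule inf_mono)
  also have "\<dots> = d *\<^sub>R inf a b"
    by (rule scaleR_inf[symmetric]) (simp add: d_def)
  finally show "inf a (c *\<^sub>R b) \<le> 0"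
    using assms(3) by simp
qed (use assms in \<open>simp add: scaleR_nonneg_nonneg\<close>)

lemma disjoint_sum:
  fixes a :: "'a::banach_lattice"
  assumes "finite I" "0 \<le> a" "\<And>i. i \<in> I \<Longrightarrow> 0 \<le> b i" "\<And>i. i \<in> I \<Longrightarrow> inf a (b i) = 0"
  shows "inf a (\<Sum>i\<in>I. b i) = 0"
  using assms(1,3,4)
proof (induction I rule: finite_induct)
  case empty
  then show ?case using assms(2) by (simp add: inf_absorb2)
next
  case (insert i I)
  then have "inf a (b i + sum b I) \<le> inf a (b i) + inf a (sum b I)"
    using assms(2) by (intro inf_add_le) (auto intro: sum_nonneg)
  also have "\<dots> = 0" using insert by simp
  finally show ?case
    using insert assms(2) by (intro antisym) (auto intro!: sum_nonneg add_nonneg_nonneg)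
qed

text \<open>The positive cone is closed, because the negative part of a limit \<open>l\<close> is dominated by
  \<open>\<bar>x n - l\<bar>\<close> for each positive \<open>x n\<close>.\<close>
lemma nonneg_limit:
  fixes x :: "nat \<Rightarrow> 'a::banach_lattice"
  assumes "x \<longlonglongrightarrow> l" "\<And>n. 0 \<le> x n"
  shows "0 \<le> l"
proof -
  have "norm (pprt (- l)) \<le> norm (x n - l)" for n
  proof -
    have "- l \<le> x n - l" using assms(2)[of n] by simp
    also have "\<dots> \<le> \<bar>x n - l\<bar>" by (rule abs_ge_self)
    finally have "pprt (- l) \<le> \<bar>x n - l\<bar>" by (simp add: pprt_def)
    from norm_mono_nonneg[OF zero_le_pprt this] show ?thesis by simp
  qed
  moreover have "(\<lambda>n. norm (x n - l)) \<longlonglongrightarrow> 0"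
    using assms(1) by (simp add: LIM_zero tendsto_norm_zero)
  ultimately have "norm (pprt (- l)) \<le> 0"
    by (intro LIMSEQ_le_const) auto
  then show ?thesis
    by (simp add: le_zero_iff_zero_pprt[symmetric])
qed

lemma suminf_ge_term:
  fixes x :: "nat \<Rightarrow> 'a::banach_lattice"
  assumes "summable x" "\<And>n. 0 \<le> x n"
  shows "x m \<le> suminf x"
proof -
  have "(\<lambda>n. (\<Sum>i<n + Suc m. x i) - x m) \<longlonglongrightarrow> suminf x - x m"
    using assms(1) by (intro tendsto_intros LIMSEQ_ignore_initial_segment summable_LIMSEQ)
  moreover have "0 \<le> (\<Sum>i<n + Suc m. x i) - x m" for n
    using assms(2) sum_mono2[of "{..<n + Suc m}" "{m}" x]
    by simp
  ultimately have "0 \<le> suminf x - x m"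
    by (rule nonneg_limit)
  then show ?thesis by simp
qed

section \<open>Positive functionals\<close>

lemma blinfun_nonneg_iff: "0 \<le> g \<longleftrightarrow> (\<forall>x\<ge>0. 0 \<le> blinfun_apply g x)"
  for g :: "'a::banach_lattice \<Rightarrow>\<^sub>L 'b::banach_lattice"
  by (simp add: less_eq_blinfun_def)

lemma nonneg_blinfun_mono:
  fixes g :: "'a::banach_lattice \<Rightarrow>\<^sub>L 'b::banach_lattice"
  assumes "0 \<le> g" "x \<le> y"
  shows "g x \<le> g y"
  using assms blinfun_nonneg_iff[of g] by (force simp: blinfun.diff_right dest: spec[of _ "y - x"])

lemma nonneg_blinfun_abs:
  fixes g :: "'a::banach_lattice \<Rightarrow>\<^sub>L 'b::banach_lattice"
  assumes "0 \<le> g"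
  shows "\<bar>g x\<bar> \<le> g \<bar>x\<bar>"
  using nonneg_blinfun_mono[OF assms abs_ge_self[of x]] nonneg_blinfun_mono[OF assms abs_ge_minus_self[of x]]
  by (intro abs_leI) (simp_all add: blinfun.minus_right)

lemma nonneg_functional_bound:
  fixes g :: "'a::banach_lattice \<Rightarrow>\<^sub>L real"
  assumes "0 \<le> g" "0 \<le> b" "\<And>x. 0 \<le> x \<Longrightarrow> g x \<le> b * norm x"
  shows "norm g \<le> b"
proof (rule norm_blinfun_bound[OF assms(2)])
  fix x
  have "\<bar>g x\<bar> \<le> g \<bar>x\<bar>" by (rule nonneg_blinfun_abs[OF assms(1)])
  also have "\<dots> \<le> b * norm x" using assms(3)[of "\<bar>x\<bar>"] by simp
  finally show "norm (g x) \<le> b * norm x" by simp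
qed

lemma nonneg_functional_norm_mono:
  fixes g h :: "'a::banach_lattice \<Rightarrow>\<^sub>L real"
  assumes "0 \<le> g" "g \<le> h"
  shows "norm g \<le> norm h"
proof (rule nonneg_functional_bound[OF assms(1)])
  fix x :: 'a assume "0 \<le> x"
  then have "g x \<le> h x" using assms(2) by (simp add: less_eq_blinfun_def)
  also have "\<dots> \<le> norm h * norm x" using norm_blinfun[of h x] by simp
  finally show "g x \<le> norm h * norm x" .
qed simp

text \<open>Comparing \<open>n *\<^sub>R (t *\<^sub>R x)\<close> with the integer multiples of \<open>x\<close> next to it shows that \<open>p (t *\<^sub>R x)\<close>
  differs from \<open>t * p x\<close> by at most \<open>p x / n\<close>.\<close>
lemma additive_nonneg_scaleR:
  fixes p :: "'a::banach_lattice \<Rightarrow> real"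
  assumes nonneg: "\<And>x. 0 \<le> x \<Longrightarrow> 0 \<le> p x"
    and add: "\<And>x y. 0 \<le> x \<Longrightarrow> 0 \<le> y \<Longrightarrow> p (x + y) = p x + p y"
    and "0 \<le> t" "0 \<le> x"
  shows "p (t *\<^sub>R x) = t * p x"
proof -
  have mono: "p a \<le> p b" if "0 \<le> a" "a \<le> b" for a b
    using add[of a "b - a"] nonneg[of "b - a"] that by simp
  have mult: "p (real n *\<^sub>R y) = real n * p y" if "0 \<le> y" for n y
  proof (induction n)
    case 0
    show ?case using add[of 0 0] by simp
  next
    case (Suc n)
    have "p (real (Suc n) *\<^sub>R y) = p (real n *\<^sub>R y + y)"
      by (simp add: algebra_simps)
    also have "\<dots> = p (real n *\<^sub>R y) + p y"
      using that by (intro add) (simp_all add: scaleR_nonneg_nonneg)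
    finally show ?case using Suc by (simp add: algebra_simps)
  qed
  have tx: "0 \<le> t *\<^sub>R x" using assms(3,4) by (simp add: scaleR_nonneg_nonneg)
  have "real n * \<bar>p (t *\<^sub>R x) - t * p x\<bar> \<le> p x" for n :: nat
  proof -
    define m where "m = nat \<lfloor>real n * t\<rfloor>"
    have m: "real m \<le> real n * t" "real n * t \<le> real (Suc m)"
      using assms(3) by (auto simp: m_def of_nat_nat) linarith
    have "p (real m *\<^sub>R x) \<le> p ((real n * t) *\<^sub>R x)"
      using m assms(4) by (intro mono) (simp_all add: scaleR_nonneg_nonneg scaleR_right_mono)
    moreover have "p ((real n * t) *\<^sub>R x) \<le> p (real (Suc m) *\<^sub>R x)"
      using m assms(3,4) by (intro mono scaleR_right_mono) (simp_all add: scaleR_nonneg_nonneg)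
    moreover have "p ((real n * t) *\<^sub>R x) = real n * p (t *\<^sub>R x)"
      using mult[OF tx, of n] by simp
    moreover have "real m * p x \<le> real n * t * p x" "real n * t * p x \<le> real (Suc m) * p x"
      using m nonneg[OF assms(4)] by (auto intro: mult_right_mono)
    ultimately have "\<bar>real n * p (t *\<^sub>R x) - real n * t * p x\<bar> \<le> p x"
      unfolding mult[OF assms(4)] by (simp add: algebra_simps abs_le_iff)
    moreover have "real n * p (t *\<^sub>R x) - real n * t * p x = real n * (p (t *\<^sub>R x) - t * p x)"
      by (simp add: algebra_simps)
    ultimately show ?thesis by (simp add: abs_mult)
  qed
  then have "\<bar>p (t *\<^sub>R x) - t * p x\<bar> \<le> 0"
    using reals_Archimedean3[of "\<bar>p (t *\<^sub>R x) - t * p x\<bar>"] by (meson not_le)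
  then show ?thesis by simp
qed

text \<open>This is how all functionals below are built: it suffices to give them on the positive cone,
  and to check additivity and a norm bound there.\<close>
lemma Kantorovich_extension:
  fixes p :: "'a::banach_lattice \<Rightarrow> real"
  assumes nonneg: "\<And>x. 0 \<le> x \<Longrightarrow> 0 \<le> p x"
    and add: "\<And>x y. 0 \<le> x \<Longrightarrow> 0 \<le> y \<Longrightarrow> p (x + y) = p x + p y"
    and bound: "\<And>x. 0 \<le> x \<Longrightarrow> p x \<le> C * norm x"
  obtains G :: "'a \<Rightarrow>\<^sub>L real" where "0 \<le> G" "\<And>x. 0 \<le> x \<Longrightarrow> G x = p x"
proof -
  define G where "G x = p (pprt x) - p (pprt (- x))" for x
  have p0: "p 0 = 0" using add[of 0 0] by simp
  \<comment> \<open>The value does not depend on how \<open>x\<close> is written as a difference of positive elements, which gives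
      linearity.\<close>
  have decomp: "G x = p a - p b" if "x = a - b" "0 \<le> a" "0 \<le> b" for x a b
  proof -
    have "pprt x = pprt (- x) + (a - b)"
      using pprt_minus_pprt[of x] that(1) by (metis add.commute diff_add_cancel)
    then have "pprt x + b = pprt (- x) + a"
      by simp
    then have "p (pprt x) + p b = p (pprt (- x)) + p a"
      using add[of "pprt x" b] add[of "pprt (- x)" a] that by simp
    then show ?thesis by (simp add: G_def)
  qed
  have G_pos: "G x = p x" if "0 \<le> x" for x
    using decomp[of x x 0] that p0 by simp
  have G_add: "G (x + y) = G x + G y" for x y
  proof -
    have "x + y = (pprt x + pprt y) - (pprt (- x) + pprt (- y))"
      using pprt_minus_pprt[of x] pprt_minus_pprt[of y] by (simp add: algebra_simps)
    then have "G (x + y) = p (pprt x + pprt y) - p (pprt (- x) + pprt (- y))"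
      by (rule decomp) simp_all
    then show ?thesis by (simp add: add G_def)
  qed
  have G_minus: "G (- x) = - G x" for x
    by (simp add: G_def)
  have G_scale_nonneg: "G (t *\<^sub>R x) = t * G x" if "0 \<le> t" for t x
  proof -
    have "t *\<^sub>R x = t *\<^sub>R pprt x - t *\<^sub>R pprt (- x)"
      by (simp only: scaleR_diff_right[symmetric] pprt_minus_pprt)
    then have "G (t *\<^sub>R x) = p (t *\<^sub>R pprt x) - p (t *\<^sub>R pprt (- x))"
      by (rule decomp) (use that in \<open>simp_all add: scaleR_nonneg_nonneg\<close>)
    then show ?thesis
      using additive_nonneg_scaleR[of p t, OF nonneg add that] by (simp add: G_def algebra_simps)
  qed
  have G_scale: "G (t *\<^sub>R x) = t * G x" for t x
    using G_scale_nonneg[of t x] G_scale_nonneg[of "- t" x] G_minus[of "t *\<^sub>R x"]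
    by (cases "0 \<le> t") auto
  have G_bound: "norm (G x) \<le> norm x * C" for x
  proof -
    have "\<bar>G x\<bar> \<le> p (pprt x) + p (pprt (- x))"
      using nonneg[of "pprt x"] nonneg[of "pprt (- x)"] by (simp add: G_def)
    also have "\<dots> = p \<bar>x\<bar>"
      by (subst add[symmetric]) (simp_all only: pprt_plus_pprt zero_le_pprt)
    also have "\<dots> \<le> C * norm x" using bound[of "\<bar>x\<bar>"] by simp
    finally show ?thesis by (simp add: mult.commute)
  qed
  have "bounded_linear G"
    by (rule bounded_linear_intro[of G C]) (auto simp: G_add G_scale intro: G_bound[unfolded real_norm_def])
  then have apply_G: "blinfun_apply (Blinfun G) = G"
    by (rule bounded_linear_Blinfun_apply)
  show thesis
    by (rule that[of "Blinfun G"]) (simp_all add: blinfun_nonneg_iff apply_G G_pos nonneg)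
qed

text \<open>Truncating \<open>y\<close> to the order interval \<open>{- a..a}\<close> leaves a remainder in \<open>{- b..b}\<close>.\<close>
lemma Riesz_decomposition:
  fixes y :: "'a::banach_lattice"
  assumes "0 \<le> a" "0 \<le> b" "\<bar>y\<bar> \<le> a + b"
  obtains u v where "y = u + v" "\<bar>u\<bar> \<le> a" "\<bar>v\<bar> \<le> b"
proof
  define u where "u = inf (sup y (- a)) a"
  have y: "y \<le> a + b" "- y \<le> a + b" using assms(3) by (auto simp: abs_le_iff)
  show "y = u + (y - u)" by simp
  have "- a \<le> a" using assms(1) by (simp add: minus_le_self_iff)
  then have "u \<le> a" "- a \<le> u" by (simp_all add: u_def)
  then show "\<bar>u\<bar> \<le> a" by (simp add: abs_le_iff minus_le_iff)
  have "u \<le> y + b" 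
  proof -
    have "- y - b \<le> a" using y(2) by (simp add: diff_le_eq)
    then have "- a \<le> y + b" by (simp add: minus_le_iff[of a])
    moreover have "y \<le> y + b" using assms(2) by simp
    ultimately show ?thesis by (auto simp: u_def intro: le_infI1)
  qed
  moreover have "y - b \<le> u"
  proof -
    have "y - b \<le> y" "y - b \<le> a" using assms(2) y by (simp_all add: algebra_simps)
    then show ?thesis by (auto simp: u_def intro: le_supI1)
  qed
  ultimately show "\<bar>y - u\<bar> \<le> b"
    by (simp add: abs_le_iff algebra_simps)
qed

text \<open>The functional \<open>a\<close> is the modulus of \<open>f\<close>, given on the positive cone by the Riesz-Kantorovich
  formula \<open>a x = (SUP y\<in>{- x..x}. f y)\<close>. Its additivity is the Riesz decomposition property.\<close>
lemma functional_modulus: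
  fixes f :: "'a::banach_lattice \<Rightarrow>\<^sub>L real"
  obtains a :: "'a \<Rightarrow>\<^sub>L real" where "0 \<le> a" "f \<le> a" "- f \<le> a" "norm a \<le> norm f"
proof -
  define S where "S x = {f y |y. \<bar>y\<bar> \<le> x}" for x
  define p where "p x = Sup (S x)" for x
  have le: "f y \<le> norm f * norm x" if "\<bar>y\<bar> \<le> x" for x y
  proof -
    have "f y \<le> norm f * norm y" using norm_blinfun[of f y] by simp
    also have "norm y \<le> norm x"
      using norm_mono_nonneg[of "\<bar>y\<bar>" x] that by simp
    finally show ?thesis by (simp add: mult_left_mono)
  qed
  have bdd: "bdd_above (S x)" for x
    unfolding bdd_above_def S_def using le[of _ x] by blast
  have mem: "f y \<in> S x" if "\<bar>y\<bar> \<le> x" for x y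
    using that by (auto simp: S_def)
  have ne: "S x \<noteq> {}" if "0 \<le> x" for x
    using mem[of 0 x] that by auto
  have upper: "f y \<le> p x" if "\<bar>y\<bar> \<le> x" for x y
    unfolding p_def by (rule cSup_upper[OF mem[OF that] bdd])
  have least: "p x \<le> c" if "0 \<le> x" "\<And>y. \<bar>y\<bar> \<le> x \<Longrightarrow> f y \<le> c" for x c
    unfolding p_def by (rule cSup_least[OF ne[OF that(1)]]) (use that(2) in \<open>auto simp: S_def\<close>)
  have p_add: "p (x + y) = p x + p y" if xy: "0 \<le> x" "0 \<le> y" for x y
  proof (rule antisym)
    show "p (x + y) \<le> p x + p y"
    proof (rule least)
      fix z assume "\<bar>z\<bar> \<le> x + y"
      then obtain u v where "z = u + v" "\<bar>u\<bar> \<le> x" "\<bar>v\<bar> \<le> y"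
        using Riesz_decomposition[OF xy] by blast
      then show "f z \<le> p x + p y"
        using upper[of u x] upper[of v y] by (simp add: blinfun.add_right)
    qed (use xy in simp)
    have "p x \<le> p (x + y) - p y"
    proof (rule least[OF xy(1)])
      fix u assume u: "\<bar>u\<bar> \<le> x"
      have "p y \<le> p (x + y) - f u"
      proof (rule least[OF xy(2)])
        fix v assume "\<bar>v\<bar> \<le> y"
        then have "\<bar>u + v\<bar> \<le> x + y"
          using u by (meson abs_triangle_ineq add_mono order_trans)
        from upper[OF this] show "f v \<le> p (x + y) - f u"
          by (simp add: blinfun.add_right)
      qed
      then show "f u \<le> p (x + y) - p y" by simp
    qed
    then show "p x + p y \<le> p (x + y)" by simp
  qed
  have p_nonneg: "0 \<le> p x" if "0 \<le> x" for x
    using upper[of 0 x] that by simp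
  have p_bound: "p x \<le> norm f * norm x" if "0 \<le> x" for x
    using that le by (intro least) auto
  obtain a :: "'a \<Rightarrow>\<^sub>L real" where a: "0 \<le> a" "\<And>x. 0 \<le> x \<Longrightarrow> a x = p x"
    using Kantorovich_extension[OF p_nonneg p_add p_bound] by blast
  show thesis
  proof (rule that[OF a(1)])
    show "f \<le> a" "- f \<le> a"
      using upper[of x x for x] upper[of "- x" x for x]
      by (auto simp: less_eq_blinfun_def a(2) blinfun.minus_left blinfun.minus_right)
    show "norm a \<le> norm f"
      by (rule nonneg_functional_bound[OF a(1)]) (use a(2) p_bound in auto)
  qed
qed

section \<open>Weakly null sequences\<close>

lemma subsequence_choice:
  fixes Q :: "nat \<Rightarrow> bool"
  assumes "\<And>k N. \<exists>n>N. Q n \<and> P k N n"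
  obtains r :: "nat \<Rightarrow> nat" where "strict_mono r" "\<And>k. Q (r k)" "\<And>k. P k (r k) (r (Suc k))"
proof -
  have "\<exists>r. \<forall>k. Q (r k) \<and> (r k < r (Suc k) \<and> P k (r k) (r (Suc k)))"
    by (rule dependent_nat_choice) (use assms in blast)+
  then show thesis
    using that by (auto simp: strict_mono_Suc_iff)
qed

text \<open>
  A gliding hump. If \<open>\<bar>\<phi> n (f n)\<bar> \<ge> \<delta>\<close> for infinitely many \<open>n\<close>, choose such indices \<open>r k\<close> so sparsely that
  in \<open>\<Sum>i. \<phi> (r i) (f (r k))\<close> the terms before the \<open>k\<close>-th are small because \<open>f\<close> is weakly null, and
  the terms after it are small as the tail of a convergent series. Then the bounded
  functional \<open>\<Sum>i. \<phi> (r i)\<close> contradicts the weak convergence.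
\<close>
lemma weakly_null_diagonal:
  fixes \<phi> :: "nat \<Rightarrow> 'a::real_normed_vector \<Rightarrow>\<^sub>L real" and f :: "nat \<Rightarrow> 'a"
  assumes bound: "\<And>x N. (\<Sum>n<N. \<bar>\<phi> n x\<bar>) \<le> C * norm x"
    and null: "\<And>\<Phi> :: 'a \<Rightarrow>\<^sub>L real. (\<lambda>n. \<Phi> (f n)) \<longlonglongrightarrow> 0"
  shows "(\<lambda>n. \<phi> n (f n)) \<longlonglongrightarrow> 0"
proof (rule ccontr)
  assume "\<not> ?thesis"
  then obtain \<delta> where "\<delta> > 0" and often: "\<And>N. \<exists>n\<ge>N. \<delta> \<le> \<bar>\<phi> n (f n)\<bar>"
    unfolding LIMSEQ_iff by (auto simp: not_less)
  have summable_abs: "summable (\<lambda>n. \<bar>\<phi> n x\<bar>)" for x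
    by (rule summableI_nonneg_bounded[OF _ bound]) simp
  have suminf_abs: "(\<Sum>n. \<bar>\<phi> n x\<bar>) \<le> C * norm x" for x
    by (rule suminf_le_const[OF summable_abs bound])
  \<comment> \<open>\<open>N\<close> and \<open>n\<close> are consecutive chosen indices: the terms up to \<open>N\<close> are small at \<open>f n\<close>, and those
      from \<open>n\<close> on are small at \<open>f N\<close>.\<close>
  define P where "P N n \<longleftrightarrow> (\<Sum>j\<le>N. \<bar>\<phi> j (f n)\<bar>) < \<delta> / 4 \<and> (\<Sum>j. \<bar>\<phi> (j + n) (f N)\<bar>) < \<delta> / 4" for N n
  have "\<exists>n>N. \<delta> \<le> \<bar>\<phi> n (f n)\<bar> \<and> P N n" for N
  proof -
    have "(\<lambda>n. \<Sum>j\<le>N. \<bar>\<phi> j (f n)\<bar>) \<longlonglongrightarrow> (\<Sum>j\<le>N. 0)"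
      by (intro tendsto_sum tendsto_rabs_zero null)
    then have "(\<lambda>n. \<Sum>j\<le>N. \<bar>\<phi> j (f n)\<bar>) \<longlonglongrightarrow> 0" by simp
    then have "\<forall>\<^sub>F n in sequentially. (\<Sum>j\<le>N. \<bar>\<phi> j (f n)\<bar>) < \<delta> / 4"
      by (rule order_tendstoD) (use \<open>\<delta> > 0\<close> in simp)
    then obtain N1 where N1: "\<And>n. n \<ge> N1 \<Longrightarrow> (\<Sum>j\<le>N. \<bar>\<phi> j (f n)\<bar>) < \<delta> / 4"
      by (auto simp: eventually_sequentially)
    obtain N2 where N2: "\<And>n. n \<ge> N2 \<Longrightarrow> norm (\<Sum>j. \<bar>\<phi> (j + n) (f N)\<bar>) < \<delta> / 4"
      using suminf_exist_split[OF _ summable_abs[of "f N"], of "\<delta> / 4"] \<open>\<delta> > 0\<close> by auto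
    obtain n where "n \<ge> max (Suc N) (max N1 N2)" "\<delta> \<le> \<bar>\<phi> n (f n)\<bar>"
      using often by blast
    then show ?thesis
      using N1[of n] N2[of n] by (intro exI[of _ n]) (auto simp: P_def)
  qed
  then obtain r where r: "strict_mono r" "\<And>k. \<delta> \<le> \<bar>\<phi> (r k) (f (r k))\<bar>" "\<And>k. P (r k) (r (Suc k))"
    using subsequence_choice[of "\<lambda>n. \<delta> \<le> \<bar>\<phi> n (f n)\<bar>" "\<lambda>_. P"] by metis
  have inj: "inj r" using r(1) by (rule strict_mono_imp_inj_on)
  have sub_abs: "summable (\<lambda>k. \<bar>\<phi> (r k) x\<bar>)" for x
    using summable_reindex[OF summable_abs inj, of x] by (simp add: o_def)
  then have sub: "summable (\<lambda>k. \<phi> (r k) x)" for x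
    by (rule summable_rabs_cancel)
  define \<Phi> where "\<Phi> x = (\<Sum>k. \<phi> (r k) x)" for x
  have "bounded_linear \<Phi>"
  proof (rule bounded_linear_intro)
    show "\<Phi> (x + y) = \<Phi> x + \<Phi> y" for x y
      using suminf_add[OF sub[of x] sub[of y]] by (simp add: \<Phi>_def blinfun.add_right)
    show "\<Phi> (c *\<^sub>R x) = c *\<^sub>R \<Phi> x" for c x
      using suminf_mult[OF sub[of x], of c] by (simp add: \<Phi>_def blinfun.scaleR_right)
    show "norm (\<Phi> x) \<le> norm x * C" for x
    proof -
      have "\<bar>\<Phi> x\<bar> \<le> (\<Sum>k. \<bar>\<phi> (r k) x\<bar>)"
        unfolding \<Phi>_def by (rule summable_rabs[OF sub_abs])
      also have "\<dots> \<le> (\<Sum>n. \<bar>\<phi> n x\<bar>)"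
        using suminf_reindex_mono[OF summable_abs inj, of x] by (simp add: o_def)
      also have "\<dots> \<le> C * norm x" by (rule suminf_abs)
      finally show ?thesis by (simp add: mult.commute)
    qed
  qed
  then have "(\<lambda>n. \<Phi> (f n)) \<longlonglongrightarrow> 0"
    using null[of "Blinfun \<Phi>"] by (simp add: bounded_linear_Blinfun_apply)
  moreover have "strict_mono (\<lambda>k. r (Suc k))"
    using r(1) by (simp add: strict_mono_def)
  ultimately have "(\<lambda>k. \<Phi> (f (r (Suc k)))) \<longlonglongrightarrow> 0"
    using LIMSEQ_subseq_LIMSEQ[of "\<lambda>n. \<Phi> (f n)" 0 "\<lambda>k. r (Suc k)"] by (simp add: o_def)
  then have "(\<lambda>k. \<bar>\<Phi> (f (r (Suc k)))\<bar>) \<longlonglongrightarrow> 0"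
    by (rule tendsto_rabs_zero)
  moreover have "\<delta> / 2 \<le> \<bar>\<Phi> (f (r (Suc k)))\<bar>" for k
  proof -
    define y where "y = f (r (Suc k))"
    define t where "t i = \<phi> (r i) y" for i
    have "\<Phi> y = (\<Sum>i. t (i + Suc (Suc k))) + (\<Sum>i<Suc (Suc k). t i)"
      unfolding \<Phi>_def t_def by (rule suminf_split_initial_segment[OF sub])
    then have split: "\<Phi> y = (\<Sum>i. t (i + Suc (Suc k))) + (\<Sum>i<Suc k. t i) + t (Suc k)"
      by simp
    have "\<bar>\<Sum>i<Suc k. t i\<bar> \<le> (\<Sum>i<Suc k. \<bar>t i\<bar>)" by (rule sum_abs)
    also have "\<dots> = (\<Sum>j\<in>r ` {..<Suc k}. \<bar>\<phi> j y\<bar>)"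
      using inj by (simp add: sum.reindex inj_on_def inj_def t_def)
    also have "\<dots> \<le> (\<Sum>j\<le>r k. \<bar>\<phi> j y\<bar>)"
      using r(1) by (intro sum_mono2) (auto simp: strict_mono_less_eq)
    also have "\<dots> < \<delta> / 4" using r(3)[of k] by (simp add: P_def y_def)
    finally have head: "\<bar>\<Sum>i<Suc k. t i\<bar> < \<delta> / 4" .
    \<comment> \<open>Reindexing by \<open>g\<close> embeds the terms after \<open>r (Suc k)\<close> into the tail of the full series that
        the choice of \<open>r (Suc (Suc k))\<close> made small.\<close>
    define g where "g i = r (i + Suc (Suc k)) - r (Suc (Suc k))" for i
    have g: "r (i + Suc (Suc k)) = g i + r (Suc (Suc k))" for i
      using r(1) by (simp add: g_def strict_mono_less_eq)
    have "inj g"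
      by (rule injI) (use g inj in \<open>metis add_right_cancel injD\<close>)
    have tail_abs: "summable (\<lambda>j. \<bar>\<phi> (j + r (Suc (Suc k))) y\<bar>)"
      by (rule summable_ignore_initial_segment[OF summable_abs])
    have t_abs: "summable (\<lambda>i. \<bar>t (i + Suc (Suc k))\<bar>)"
      unfolding t_def by (rule summable_ignore_initial_segment[OF sub_abs])
    have "\<bar>\<Sum>i. t (i + Suc (Suc k))\<bar> \<le> (\<Sum>i. \<bar>t (i + Suc (Suc k))\<bar>)"
      by (rule summable_rabs[OF t_abs])
    also have "\<dots> = suminf ((\<lambda>j. \<bar>\<phi> (j + r (Suc (Suc k))) y\<bar>) \<circ> g)"
      unfolding t_def g by (simp add: o_def)
    also have "\<dots> \<le> (\<Sum>j. \<bar>\<phi> (j + r (Suc (Suc k))) y\<bar>)"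
      by (rule suminf_reindex_mono[OF tail_abs \<open>inj g\<close>]) simp
    also have "\<dots> < \<delta> / 4" using r(3)[of "Suc k"] by (simp add: P_def y_def)
    finally have tail: "\<bar>\<Sum>i. t (i + Suc (Suc k))\<bar> < \<delta> / 4" .
    have "\<delta> \<le> \<bar>t (Suc k)\<bar>" using r(2)[of "Suc k"] by (simp add: t_def y_def)
    with head tail split show ?thesis unfolding y_def by linarith
  qed
  ultimately have "\<delta> / 2 \<le> 0"
    by (intro LIMSEQ_le_const) auto
  with \<open>\<delta> > 0\<close> show False by simp
qed

lemma norm_blinfun_witness:
  fixes f :: "'a::real_normed_vector \<Rightarrow>\<^sub>L real"
  assumes "c < norm f" "0 \<le> c"
  obtains v where "norm v = 1" "c < \<bar>f v\<bar>"
proof -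
  obtain x where x: "c * norm x < \<bar>f x\<bar>"
    using norm_blinfun_bound[OF assms(2), of f] assms(1) by (auto simp: not_le[symmetric])
  then have "x \<noteq> 0" by auto
  with x show thesis
    by (intro that[of "inverse (norm x) *\<^sub>R x"])
      (simp_all add: blinfun.scaleR_right abs_mult field_simps)
qed

text \<open>
  Uniform boundedness as another use of the diagonal lemma: if \<open>norm (f (r (Suc k))) > 2 ^ k\<close>, evaluate
  \<open>f (r (Suc k))\<close> at nearly norming vectors of norm \<open>(1 / 2) ^ k\<close>. These evaluations are absolutely
  summable, but their values on the sequence stay above 1.
\<close>
lemma weakly_null_functionals_bounded:
  fixes f :: "nat \<Rightarrow> 'a::real_normed_vector \<Rightarrow>\<^sub>L real"
  assumes null: "\<And>\<Phi> :: ('a \<Rightarrow>\<^sub>L real) \<Rightarrow>\<^sub>L real. (\<lambda>n. \<Phi> (f n)) \<longlonglongrightarrow> 0"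
  obtains M where "0 < M" "\<And>n. norm (f n) \<le> M"
proof (rule ccontr)
  assume "\<not> thesis"
  with that have "\<not> Bseq f" by (auto simp: Bseq_def)
  have large: "\<exists>n>N. True \<and> 2 ^ k < norm (f n)" for k N
  proof (rule ccontr)
    assume "\<not> ?thesis"
    then have "norm (f n) \<le> 2 ^ k" if "N < n" for n
      using that by (meson not_less)
    then have "Bseq (\<lambda>n. f (n + Suc N))"
      by (intro BseqI'[of _ "2 ^ k"]) simp
    then show False using \<open>\<not> Bseq f\<close> Bseq_offset by blast
  qed
  obtain r where r: "strict_mono r" "\<And>k. 2 ^ k < norm (f (r (Suc k)))"
  proof (rule subsequence_choice[of "\<lambda>_. True" "\<lambda>k N n. 2 ^ k < norm (f n)", OF large])
    fix r assume "strict_mono r" "\<And>k. 2 ^ k < norm (f (r (Suc k)))"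
    then show thesis by (rule that)
  qed
  have "\<exists>v. norm v = 1 \<and> 2 ^ k < \<bar>f (r (Suc k)) v\<bar>" for k
    using norm_blinfun_witness[OF r(2), of k] by auto
  then obtain v where v: "\<And>k. norm (v k) = 1" "\<And>k. 2 ^ k < \<bar>f (r (Suc k)) (v k)\<bar>"
    by metis
  define \<phi> where "\<phi> k = Blinfun (\<lambda>h :: 'a \<Rightarrow>\<^sub>L real. h ((1 / 2) ^ k *\<^sub>R v k))" for k
  have \<phi>: "\<phi> k h = h ((1 / 2) ^ k *\<^sub>R v k)" for k h
    unfolding \<phi>_def by (subst bounded_linear_Blinfun_apply) (auto intro: blinfun.bounded_linear_left)
  have "(\<lambda>k. \<phi> k (f (r (Suc k)))) \<longlonglongrightarrow> 0"
  proof (rule weakly_null_diagonal)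
    fix h :: "'a \<Rightarrow>\<^sub>L real" and N
    have "\<bar>\<phi> k h\<bar> \<le> (1 / 2) ^ k * norm h" for k
      using norm_blinfun[of h "(1 / 2) ^ k *\<^sub>R v k"] by (simp add: \<phi> v mult.commute)
    then have "(\<Sum>k<N. \<bar>\<phi> k h\<bar>) \<le> (\<Sum>k<N. (1 / 2) ^ k * norm h)"
      by (intro sum_mono)
    also have "\<dots> = (\<Sum>k<N. (1 / 2) ^ k) * norm h"
      by (simp add: sum_distrib_right)
    also have "\<dots> \<le> 2 * norm h"
      by (intro mult_right_mono) (simp_all add: geometric_sum)
    finally show "(\<Sum>k<N. \<bar>\<phi> k h\<bar>) \<le> 2 * norm h" .
  next
    fix \<Phi> :: "('a \<Rightarrow>\<^sub>L real) \<Rightarrow>\<^sub>L real"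
    have "strict_mono (\<lambda>k. r (Suc k))"
      using r(1) by (simp add: strict_mono_def)
    from LIMSEQ_subseq_LIMSEQ[OF null[of \<Phi>] this] show "(\<lambda>k. \<Phi> (f (r (Suc k)))) \<longlonglongrightarrow> 0"
      by (simp add: o_def)
  qed
  then have "(\<lambda>k. \<bar>\<phi> k (f (r (Suc k)))\<bar>) \<longlonglongrightarrow> 0"
    by (rule tendsto_rabs_zero)
  moreover have "1 \<le> \<bar>\<phi> k (f (r (Suc k)))\<bar>" for k
    using v(2)[of k] by (simp add: \<phi> blinfun.scaleR_right abs_mult power_one_over field_simps)
  ultimately have "(1::real) \<le> 0"
    by (intro LIMSEQ_le_const) auto
  then show False by simp
qed

section \<open>The Hahn-Banach theorem\<close>

definition sublinear :: "('a::real_vector \<Rightarrow> real) \<Rightarrow> bool" where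
  "sublinear q \<longleftrightarrow> (\<forall>x y. q (x + y) \<le> q x + q y) \<and> (\<forall>t>0. \<forall>x. q (t *\<^sub>R x) = t * q x)"

text \<open>The infimum over \<open>t\<close> is the largest sublinear functional \<open>q'\<close> below \<open>q\<close> that satisfies
  \<open>q' (- y) \<le> - q y\<close>. A linear functional below it is thus norming at \<open>y\<close> if \<open>q\<close> is the norm.\<close>
definition flatten :: "'a::real_vector \<Rightarrow> ('a \<Rightarrow> real) \<Rightarrow> 'a \<Rightarrow> real" where
  "flatten y q x = (INF t\<in>{0..}. q (x + t *\<^sub>R y) - t * q y)"

lemma sublinear_zero: "sublinear q \<Longrightarrow> q 0 = 0"
proof -
  assume "sublinear q"
  then have "q (2 *\<^sub>R 0) = 2 * q 0" unfolding sublinear_def by (metis zero_less_numeral)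
  then show ?thesis by simp
qed

lemma flatten_props:
  fixes q :: "'a::real_vector \<Rightarrow> real"
  assumes "sublinear q"
  shows flatten_le: "0 \<le> t \<Longrightarrow> flatten y q x \<le> q (x + t *\<^sub>R y) - t * q y"
    and sublinear_flatten: "sublinear (flatten y q)"
proof -
  have sub: "q (a + b) \<le> q a + q b" for a b
    using assms by (simp add: sublinear_def)
  have hom: "q (t *\<^sub>R a) = t * q a" if "0 \<le> t" for t a
    using assms that sublinear_zero[OF assms] by (cases "t = 0") (auto simp: sublinear_def)
  have lower: "- q (- x) \<le> q (x + t *\<^sub>R y) - t * q y" if "0 \<le> t" for x t
    using sub[of "x + t *\<^sub>R y" "- x"] hom[OF that, of y] by simp
  have bdd: "bdd_below ((\<lambda>t. q (x + t *\<^sub>R y) - t * q y) ` {0..})" for x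
    unfolding bdd_below_def using lower by auto
  show le: "flatten y q x \<le> q (x + t *\<^sub>R y) - t * q y" if "0 \<le> t" for x t
    unfolding flatten_def by (rule cINF_lower[OF bdd]) (use that in simp)
  have greatest: "c \<le> flatten y q x" if "\<And>t. 0 \<le> t \<Longrightarrow> c \<le> q (x + t *\<^sub>R y) - t * q y" for c x
    unfolding flatten_def by (rule cINF_greatest) (use that in auto)
  have add: "flatten y q (a + b) \<le> flatten y q a + flatten y q b" for a b
  proof -
    have "flatten y q (a + b) - flatten y q b \<le> flatten y q a"
    proof (rule greatest)
      fix s :: real assume s: "0 \<le> s"
      have "flatten y q (a + b) - (q (a + s *\<^sub>R y) - s * q y) \<le> flatten y q b"
      proof (rule greatest)
        fix t :: real assume t: "0 \<le> t"
        have "a + b + (s + t) *\<^sub>R y = (a + s *\<^sub>R y) + (b + t *\<^sub>R y)"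
          by (simp add: algebra_simps)
        then have "flatten y q (a + b) \<le> q ((a + s *\<^sub>R y) + (b + t *\<^sub>R y)) - (s + t) * q y"
          using le[of "s + t" "a + b"] s t by (simp only: add_nonneg_nonneg)
        also have "\<dots> \<le> q (a + s *\<^sub>R y) + q (b + t *\<^sub>R y) - (s + t) * q y"
          using sub by simp
        finally show "flatten y q (a + b) - (q (a + s *\<^sub>R y) - s * q y) \<le> q (b + t *\<^sub>R y) - t * q y"
          by (simp add: algebra_simps)
      qed
      then show "flatten y q (a + b) - flatten y q b \<le> q (a + s *\<^sub>R y) - s * q y" by simp
    qed
    then show ?thesis by simp
  qed
  have hom_le: "c * flatten y q x \<le> flatten y q (c *\<^sub>R x)" if "0 < c" for c x
  proof (rule greatest)
    fix t :: real assume t: "0 \<le> t"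
    have "c * flatten y q x \<le> c * (q (x + (t / c) *\<^sub>R y) - (t / c) * q y)"
      using that t by (intro mult_left_mono le) simp_all
    also have "\<dots> = c * q (x + (t / c) *\<^sub>R y) - t * q y"
      using that by (simp add: right_diff_distrib)
    also have "c * q (x + (t / c) *\<^sub>R y) = q (c *\<^sub>R (x + (t / c) *\<^sub>R y))"
      using hom[of c] that by simp
    also have "c *\<^sub>R (x + (t / c) *\<^sub>R y) = c *\<^sub>R x + t *\<^sub>R y"
      using that by (simp add: scaleR_add_right)
    finally show "c * flatten y q x \<le> q (c *\<^sub>R x + t *\<^sub>R y) - t * q y" .
  qed
  have "flatten y q (c *\<^sub>R x) = c * flatten y q x" if "0 < c" for c x
    using hom_le[OF that, of x] hom_le[of "inverse c" "c *\<^sub>R x"] that by (simp add: field_simps)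
  with add show "sublinear (flatten y q)" by (simp add: sublinear_def)
qed

text \<open>
  By Zorn's lemma there is a minimal sublinear functional \<open>q \<le> p\<close>. Minimality forces \<open>flatten y q = q\<close>
  for all \<open>y\<close>, which says that \<open>q (x + y) \<ge> q x + q y\<close>. Hence \<open>q\<close> is additive.
\<close>
lemma linear_below_sublinear:
  fixes p :: "'a::real_vector \<Rightarrow> real"
  assumes p: "sublinear p"
  obtains f where "linear f" "\<And>x. f x \<le> p x"
proof -
  define A where "A = {q. sublinear q \<and> q \<le> p}"
  have "\<exists>q\<in>A. \<forall>q'\<in>A. q' \<le> q \<longrightarrow> q' = q"
  proof (rule predicate_Zorn)
    show "partial_order_on A (relation_of (\<lambda>q q'. q' \<le> q) A)"
      by (auto simp: partial_order_on_def preorder_on_def refl_on_def trans_def antisym_def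
          relation_of_def intro: order_trans)
  next
    fix C assume C: "C \<in> Chains (relation_of (\<lambda>q q'. q' \<le> q) A)"
    then have CA: "C \<subseteq> A" and chain: "\<And>q q'. q \<in> C \<Longrightarrow> q' \<in> C \<Longrightarrow> q' \<le> q \<or> q \<le> q'"
      unfolding Chains_def relation_of_def by blast+
    show "\<exists>u\<in>A. \<forall>q\<in>C. u \<le> q"
    proof (cases "C = {}")
      case True
      then show ?thesis using p by (auto simp: A_def)
    next
      case False
      define u where "u x = (INF q\<in>C. q x)" for x
      have "- p (- x) \<le> q x" if "q \<in> C" for q x
      proof -
        have "sublinear q" "q (- x) \<le> p (- x)" using that CA by (auto simp: A_def le_fun_def)
        moreover from this have "q (x + - x) \<le> q x + q (- x)" by (simp only: sublinear_def)
        ultimately show ?thesis using sublinear_zero[of q] by simp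
      qed
      then have bdd: "bdd_below ((\<lambda>q. q x) ` C)" for x
        unfolding bdd_below_def by auto
      have lower: "u x \<le> q x" if "q \<in> C" for q x
        unfolding u_def by (rule cINF_lower[OF bdd that])
      have greatest: "c \<le> u x" if "\<And>q. q \<in> C \<Longrightarrow> c \<le> q x" for c x
        unfolding u_def by (rule cINF_greatest[OF False that])
      have add: "u (x + y) \<le> u x + u y" for x y
      proof -
        have "u (x + y) - u y \<le> u x"
        proof (rule greatest)
          fix q assume q: "q \<in> C"
          have "u (x + y) - q x \<le> u y"
          proof (rule greatest)
            fix q' assume q': "q' \<in> C"
            obtain m where m: "m \<in> C" "m \<le> q" "m \<le> q'"
              using chain[OF q q'] q q' by blast
            have "u (x + y) \<le> m (x + y)" by (rule lower[OF m(1)])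
            also have "\<dots> \<le> m x + m y" using m(1) CA by (auto simp: A_def sublinear_def)
            also have "\<dots> \<le> q x + q' y" using m by (intro add_mono) (auto simp: le_fun_def)
            finally show "u (x + y) - q x \<le> q' y" by simp
          qed
          then show "u (x + y) - u y \<le> q x" by simp
        qed
        then show ?thesis by simp
      qed
      have hom_le: "c * u x \<le> u (c *\<^sub>R x)" if "0 < c" for c x
      proof (rule greatest)
        fix q assume "q \<in> C"
        then have "q (c *\<^sub>R x) = c * q x" "u x \<le> q x"
          using CA that lower by (auto simp: A_def sublinear_def)
        then show "c * u x \<le> q (c *\<^sub>R x)" using that by simp
      qed
      have "u (c *\<^sub>R x) = c * u x" if "0 < c" for c x
        using hom_le[OF that, of x] hom_le[of "inverse c" "c *\<^sub>R x"] that by (simp add: field_simps)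
      with add have "sublinear u" by (simp add: sublinear_def)
      moreover have "u \<le> p"
      proof -
        obtain q where "q \<in> C" using False by blast
        then have "u \<le> q" "q \<le> p" using lower CA by (auto simp: A_def le_fun_def)
        then show ?thesis by (rule order_trans)
      qed
      ultimately have "u \<in> A" by (simp add: A_def)
      then show ?thesis using lower by (auto simp: le_fun_def)
    qed
  qed
  then obtain q where "q \<in> A" and minA: "\<forall>q'\<in>A. q' \<le> q \<longrightarrow> q' = q"
    by blast
  then have q: "sublinear q" "q \<le> p"
    by (simp_all add: A_def)
  have min: "q' = q" if "sublinear q'" "q' \<le> p" "q' \<le> q" for q'
    using minA that by (simp add: A_def)
  have "flatten y q = q" for y
  proof (rule min[OF sublinear_flatten[OF q(1)]])
    show "flatten y q \<le> q"
      using flatten_le[OF q(1), of 0 y] by (simp add: le_fun_def)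
    with q(2) show "flatten y q \<le> p" by (rule order_trans[rotated])
  qed
  then have "q x + q y \<le> q (x + y)" for x y
    using flatten_le[OF q(1), of 1 y x] by simp
  moreover have "q (x + y) \<le> q x + q y" for x y
    using q(1) by (simp add: sublinear_def)
  ultimately have add: "q (x + y) = q x + q y" for x y
    by (rule antisym[rotated])
  have minus: "q (- x) = - q x" for x
    using add[of x "- x"] sublinear_zero[OF q(1)] by simp
  have "q (c *\<^sub>R x) = c * q x" for c x
  proof (cases c "0 :: real" rule: linorder_cases)
    case less
    then have "q ((- c) *\<^sub>R x) = - c * q x" using q(1) unfolding sublinear_def by (metis neg_0_less_iff_less)
    then show ?thesis using minus[of "c *\<^sub>R x"] by simp
  qed (use q(1) sublinear_zero[OF q(1)] in \<open>auto simp: sublinear_def\<close>)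
  then have "linear q" by (intro linearI) (simp_all add: add)
  with q(2) show thesis by (intro that) (auto simp: le_fun_def)
qed

text \<open>A linear functional below \<open>flatten y norm\<close> does not exceed the norm anywhere and is at most
  \<open>- norm y\<close> at \<open>- y\<close>.\<close>
lemma norming_functional:
  fixes y :: "'a::real_normed_vector"
  obtains f :: "'a \<Rightarrow>\<^sub>L real" where "norm y \<le> f y"
proof -
  have norm: "sublinear (norm :: 'a \<Rightarrow> real)"
    by (simp add: sublinear_def norm_triangle_ineq)
  obtain f where f: "linear f" "\<And>x. f x \<le> flatten y norm x"
    using linear_below_sublinear[OF sublinear_flatten[OF norm]] by blast
  have le: "f x \<le> norm x" for x
    using f(2)[of x] flatten_le[OF norm, of 0 y x] by simp
  have "norm (f x) \<le> norm x * 1" for x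
    using le[of x] le[of "- x"] linear_neg[OF f(1), of x] by (simp add: abs_le_iff)
  then have "bounded_linear f"
    using linear_add[OF f(1)] linear_scale[OF f(1)] by (rule bounded_linear_intro[rotated 2])
  moreover have "norm y \<le> f y"
    using f(2)[of "- y"] flatten_le[OF norm, of 1 y "- y"] f(1) by (simp add: linear_neg)
  ultimately show thesis
    using that[of "Blinfun f"] by (simp add: bounded_linear_Blinfun_apply)
qed

section \<open>From disjoint sequences to an order continuous dual norm\<close>

text \<open>
  The witness is the positive part of \<open>x n - 4 ^ n *\<^sub>R (\<Sum>i<n. x i) - (1 / 2) ^ n *\<^sub>R z\<close> with
  \<open>z = (\<Sum>n. (1 / 2) ^ n *\<^sub>R x n)\<close>. For \<open>n < m\<close>, the subtracted sum makes \<open>y m\<close> live where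
  \<open>x m > 4 ^ m *\<^sub>R x n\<close>, and the subtracted multiple of \<open>z\<close> makes \<open>y n\<close> live where
  \<open>x n > (1 / 2) ^ (n + m) *\<^sub>R x m \<ge> (1 / 4) ^ m *\<^sub>R x m\<close>. These regions are disjoint.
\<close>
lemma disjointification:
  fixes x :: "nat \<Rightarrow> 'a::banach_lattice"
  assumes nonneg: "\<And>n. 0 \<le> x n" and ball: "\<And>n. norm (x n) \<le> 1"
  obtains y z where "disjoint_seq y" "\<And>n. 0 \<le> y n" "\<And>n. y n \<le> x n"
    "\<And>n. x n \<le> y n + 4 ^ n *\<^sub>R (\<Sum>i<n. x i) + (1 / 2) ^ n *\<^sub>R z"
proof -
  define z where "z = (\<Sum>n. (1 / 2) ^ n *\<^sub>R x n)"
  define y where "y n = pprt (x n - (4 ^ n *\<^sub>R (\<Sum>i<n. x i) + (1 / 2) ^ n *\<^sub>R z))" for n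
  have summable: "summable (\<lambda>n. (1 / 2) ^ n *\<^sub>R x n)"
  proof (rule summable_comparison_test')
    show "summable (\<lambda>n. (1 / 2 :: real) ^ n)" by (rule summable_geometric) simp
    show "norm ((1 / 2) ^ n *\<^sub>R x n) \<le> (1 / 2) ^ n" for n
      using ball[of n] by (simp add: mult_left_le)
  qed
  have z_ge: "(1 / 2) ^ n *\<^sub>R x n \<le> z" for n
    unfolding z_def by (rule suminf_ge_term[OF summable]) (simp add: nonneg scaleR_nonneg_nonneg)
  have z_nonneg: "0 \<le> z"
    using z_ge[of 0] nonneg[of 0] by simp
  have sum_nonneg': "0 \<le> (\<Sum>i<n. x i)" for n
    by (simp add: nonneg sum_nonneg)
  have disj: "inf (y m) (y n) = 0" if "n < m" for m n
  proof -
    have "x n \<le> (\<Sum>i<m. x i)"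
      using sum_mono2[of "{..<m}" "{n}" x] that nonneg by simp
    then have "4 ^ m *\<^sub>R x n \<le> 4 ^ m *\<^sub>R (\<Sum>i<m. x i) + (1 / 2) ^ m *\<^sub>R z"
      using z_nonneg by (intro add_increasing2) (simp_all add: scaleR_nonneg_nonneg scaleR_left_mono)
    then have ym: "y m \<le> pprt (x m - 4 ^ m *\<^sub>R x n)"
      unfolding y_def by (intro pprt_mono diff_left_mono)
    have "(1 / 2) ^ n *\<^sub>R (1 / 2) ^ m *\<^sub>R x m \<le> 4 ^ n *\<^sub>R (\<Sum>i<n. x i) + (1 / 2) ^ n *\<^sub>R z"
      using z_ge[of m] sum_nonneg'[of n]
      by (intro add_increasing) (simp_all add: scaleR_nonneg_nonneg scaleR_left_mono del: scaleR_scaleR)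
    then have "y n \<le> pprt (x n - (1 / 2) ^ n *\<^sub>R (1 / 2) ^ m *\<^sub>R x m)"
      unfolding y_def by (intro pprt_mono diff_left_mono)
    also have "\<dots> \<le> pprt (x n - (1 / 4) ^ m *\<^sub>R x m)"
    proof -
      have "(1 / 4 :: real) ^ m = (1 / 2) ^ m * (1 / 2) ^ m"
        by (simp flip: power_mult_distrib)
      also have "\<dots> \<le> (1 / 2) ^ n * (1 / 2) ^ m"
        using that by (intro mult_right_mono power_decreasing) simp_all
      finally show ?thesis
        by (intro pprt_mono diff_left_mono) (simp add: scaleR_right_mono nonneg)
    qed
    finally have yn: "y n \<le> pprt (x n - (1 / 4) ^ m *\<^sub>R x m)" .
    have c: "(0::real) \<le> (1 / 4) ^ m" by simp
    \<comment> \<open>Up to positive factors, the two upper bounds are the positive and the negative part of the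
        same element.\<close>
    have "(1 / 4) ^ m *\<^sub>R pprt (x m - 4 ^ m *\<^sub>R x n) = pprt ((1 / 4) ^ m *\<^sub>R x m - x n)"
      by (simp add: pprt_scaleR[OF c] scaleR_diff_right flip: power_mult_distrib)
    then have "inf (pprt (x n - (1 / 4) ^ m *\<^sub>R x m)) ((1 / 4) ^ m *\<^sub>R pprt (x m - 4 ^ m *\<^sub>R x n)) = 0"
      by (simp add: inf_pprt_diff)
    then have "inf (pprt (x n - (1 / 4) ^ m *\<^sub>R x m)) (4 ^ m *\<^sub>R (1 / 4) ^ m *\<^sub>R pprt (x m - 4 ^ m *\<^sub>R x n)) = 0"
      by (rule disjoint_scaleR[rotated 2]) (simp_all add: scaleR_nonneg_nonneg)
    then have "inf (pprt (x n - (1 / 4) ^ m *\<^sub>R x m)) (pprt (x m - 4 ^ m *\<^sub>R x n)) = 0"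
      by (simp flip: power_mult_distrib)
    moreover have "inf (y m) (y n) \<le> inf (pprt (x n - (1 / 4) ^ m *\<^sub>R x m)) (pprt (x m - 4 ^ m *\<^sub>R x n))"
      using inf_mono[OF yn ym] by (simp add: inf_commute)
    ultimately show ?thesis
      by (intro antisym) (simp_all add: y_def)
  qed
  have y_nonneg: "0 \<le> y n" for n by (simp add: y_def)
  show thesis
  proof (rule that[of y z])
    show "disjoint_seq y"
      unfolding disjoint_seq_def using disj y_nonneg by (metis abs_of_nonneg inf_commute nat_neq_iff)
    show "y n \<le> x n" for n
    proof -
      have "0 \<le> 4 ^ n *\<^sub>R (\<Sum>i<n. x i) + (1 / 2) ^ n *\<^sub>R z"
        using z_nonneg sum_nonneg'[of n] by (simp add: scaleR_nonneg_nonneg)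
      then have "x n - (4 ^ n *\<^sub>R (\<Sum>i<n. x i) + (1 / 2) ^ n *\<^sub>R z) \<le> x n"
        by (simp only: diff_le_eq le_add_same_cancel1)
      then show ?thesis using nonneg[of n] unfolding y_def pprt_def by (rule sup_least)
    qed
    show "x n \<le> y n + 4 ^ n *\<^sub>R (\<Sum>i<n. x i) + (1 / 2) ^ n *\<^sub>R z" for n
    proof -
      have "x n - (4 ^ n *\<^sub>R (\<Sum>i<n. x i) + (1 / 2) ^ n *\<^sub>R z) \<le> y n"
        unfolding y_def pprt_def by (rule sup_ge1)
      then show ?thesis by (simp add: diff_le_eq add.assoc)
    qed
  qed (rule y_nonneg)
qed

text \<open>The pointwise infimum of the net is additive on the positive cone because the net is directed.
  So it extends to a functional below the whole net, which can only be the zero functional.\<close>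
lemma decreasing_functionals_pointwise:
  fixes x :: "'i \<Rightarrow> 'e::banach_lattice \<Rightarrow>\<^sub>L real"
  assumes dir: "directed_set I r" and dec: "decreases_to_zero I r x" and "0 \<le> v" "0 < \<epsilon>"
  obtains j where "j \<in> I" "x j v < \<epsilon>"
proof -
  define p where "p v = (INF i\<in>I. x i v)" for v
  have ne: "I \<noteq> {}" using dir by (simp add: directed_set_def)
  have xpos: "0 \<le> x i v" if "i \<in> I" "0 \<le> v" for i v
    using dec that by (auto simp: decreases_to_zero_def blinfun_nonneg_iff)
  have mono: "x j v \<le> x i v" if "(i, j) \<in> r" "0 \<le> v" for i j v
    using dec that by (auto simp: decreases_to_zero_def less_eq_blinfun_def)
  have lower: "p v \<le> x i v" if "i \<in> I" "0 \<le> v" for i v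
    unfolding p_def by (rule cINF_lower) (use that xpos in \<open>auto simp: bdd_below_def\<close>)
  have greatest: "c \<le> p v" if "\<And>i. i \<in> I \<Longrightarrow> c \<le> x i v" for c v
    unfolding p_def by (rule cINF_greatest[OF ne that])
  have p_nonneg: "0 \<le> p v" if "0 \<le> v" for v
    by (rule greatest) (use xpos that in simp)
  have p_add: "p (a + b) = p a + p b" if ab: "0 \<le> a" "0 \<le> b" for a b
  proof (rule antisym)
    show "p a + p b \<le> p (a + b)"
      by (rule greatest) (use lower ab in \<open>auto simp: blinfun.add_right intro: add_mono\<close>)
    have "p (a + b) - p b \<le> p a"
    proof (rule greatest)
      fix i assume i: "i \<in> I"
      have "p (a + b) - x i a \<le> p b"
      proof (rule greatest)
        fix j assume j: "j \<in> I"
        obtain k where k: "k \<in> I" "(i, k) \<in> r" "(j, k) \<in> r"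
          using dir i j by (auto simp: directed_set_def)
        have "p (a + b) \<le> x k a + x k b"
          using lower[OF k(1), of "a + b"] ab by (simp add: blinfun.add_right)
        then show "p (a + b) - x i a \<le> x j b"
          using mono[OF k(2) ab(1)] mono[OF k(3) ab(2)] by simp
      qed
      then show "p (a + b) - p b \<le> x i a" by simp
    qed
    then show "p (a + b) \<le> p a + p b" by simp
  qed
  obtain i where i: "i \<in> I" using ne by blast
  have p_bound: "p v \<le> norm (x i) * norm v" if "0 \<le> v" for v
    using lower[OF i that] norm_blinfun[of "x i" v] by simp
  obtain G :: "'e \<Rightarrow>\<^sub>L real" where G: "0 \<le> G" "\<And>x. 0 \<le> x \<Longrightarrow> G x = p x"
    using Kantorovich_extension[OF p_nonneg p_add p_bound] by blast
  have "\<forall>i\<in>I. G \<le> x i"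
    using G(2) lower by (simp add: less_eq_blinfun_def)
  then have "G \<le> 0"
    using dec by (simp add: decreases_to_zero_def)
  then have "G v \<le> 0"
    using \<open>0 \<le> v\<close> by (simp add: less_eq_blinfun_def)
  then have "p v \<le> 0"
    using G(2)[OF \<open>0 \<le> v\<close>] by simp
  then have "\<not> (\<forall>j\<in>I. \<epsilon> \<le> x j v)"
    using greatest[of \<epsilon> v] \<open>0 < \<epsilon>\<close> by auto
  then show thesis using that by (auto simp: not_le)
qed

text \<open>
  Suppose the norms stay above \<open>l > 0\<close>. With \<open>s\<close> the sum of the vectors chosen so far, there are a member
  of the net (below a fixed member \<open>x i\<close>) that is smaller than \<open>l / 8 / 4 ^ n\<close> at \<open>s\<close>, and a positive vector
  of the unit ball at which this member exceeds \<open>l / 2\<close>. Disjointification costs the member at most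
  \<open>l / 8\<close> and a null sequence, so that \<open>x i\<close> does not tend to zero along the disjoint sequence.
\<close>
lemma order_continuous_dual_normI:
  assumes null: "\<And>(g :: 'e::banach_lattice \<Rightarrow>\<^sub>L real) y. 0 \<le> g \<Longrightarrow> disjoint_seq y \<Longrightarrow> (\<And>n. 0 \<le> y n) \<Longrightarrow>
    (\<And>n. norm (y n) \<le> 1) \<Longrightarrow> (\<lambda>n. blinfun_apply g (y n)) \<longlonglongrightarrow> 0"
  shows "order_continuous_norm TYPE('e \<Rightarrow>\<^sub>L real)"
  unfolding order_continuous_norm_def
proof (intro allI impI)
  fix I :: "('e \<Rightarrow>\<^sub>L real) set" and r and x :: "('e \<Rightarrow>\<^sub>L real) \<Rightarrow> 'e \<Rightarrow>\<^sub>L real"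
  assume dir: "directed_set I r" and dec: "decreases_to_zero I r x"
  have rI: "r \<subseteq> I \<times> I" using dir by (simp add: directed_set_def preorder_on_def)
  have xpos: "0 \<le> x i" if "i \<in> I" for i
    using dec that by (simp add: decreases_to_zero_def)
  have mono: "x j \<le> x i" if "(i, j) \<in> r" for i j
    using dec that by (auto simp: decreases_to_zero_def)
  have "l \<le> 0" if l: "\<And>i. i \<in> I \<Longrightarrow> l \<le> norm (x i)" for l
  proof (rule ccontr)
    assume "\<not> l \<le> 0"
    then have "0 < l" by simp
    obtain i where i: "i \<in> I" using dir by (auto simp: directed_set_def)
    have "\<exists>j v. j \<in> I \<and> x j \<le> x i \<and> 4 ^ n * x j s < l / 8 \<and> 0 \<le> v \<and> norm v \<le> 1 \<and> l / 2 < x j v"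
      if "0 \<le> s" for s and n :: nat
    proof -
      obtain j' where j': "j' \<in> I" "x j' s < l / 8 / 4 ^ n"
        using decreasing_functionals_pointwise[OF dir dec \<open>0 \<le> s\<close>, of "l / 8 / 4 ^ n"] \<open>0 < l\<close> by auto
      obtain j where j: "j \<in> I" "(i, j) \<in> r" "(j', j) \<in> r"
        using dir i j' by (auto simp: directed_set_def)
      have "x j s \<le> x j' s" using mono[OF j(3)] \<open>0 \<le> s\<close> by (simp add: less_eq_blinfun_def)
      with j'(2) have "x j s < l / 8 / 4 ^ n" by simp
      then have small: "4 ^ n * x j s < l / 8" by (simp add: field_simps)
      have "\<not> norm (x j) \<le> l / 2" using l[OF j(1)] \<open>0 < l\<close> by simp
      then obtain v where v: "0 \<le> v" "l / 2 * norm v < x j v"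
        using nonneg_functional_bound[OF xpos[OF j(1)], of "l / 2"] \<open>0 < l\<close> by (auto simp: not_le[symmetric])
      then have "v \<noteq> 0" by auto
      with v have "0 \<le> inverse (norm v) *\<^sub>R v" "norm (inverse (norm v) *\<^sub>R v) \<le> 1"
        "l / 2 < x j (inverse (norm v) *\<^sub>R v)"
        by (simp_all add: scaleR_nonneg_nonneg blinfun.scaleR_right field_simps)
      with small j mono[OF j(2)] show ?thesis by blast
    qed
    then obtain J V where JV: "\<And>s n. 0 \<le> s \<Longrightarrow> J s n \<in> I \<and> x (J s n) \<le> x i \<and> 4 ^ n * x (J s n) s < l / 8 \<and>
        0 \<le> V s n \<and> norm (V s n) \<le> 1 \<and> l / 2 < x (J s n) (V s n)"
      by metis
    define s where "s = rec_nat 0 (\<lambda>n t. t + V t n)"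
    have s_simps: "s 0 = 0" "s (Suc n) = s n + V (s n) n" for n
      by (simp_all add: s_def)
    have s_nonneg: "0 \<le> s n" for n
      by (induction n) (use JV in \<open>simp_all add: s_simps\<close>)
    define w where "w n = V (s n) n" for n
    define g where "g n = x (J (s n) n)" for n
    have s_sum: "s n = (\<Sum>k<n. w k)" for n
      by (induction n) (simp_all add: s_simps w_def)
    have w: "0 \<le> w n" "norm (w n) \<le> 1" for n
      using JV[OF s_nonneg] by (simp_all add: w_def)
    have g: "0 \<le> g n" "g n \<le> x i" "4 ^ n * g n (s n) < l / 8" "l / 2 < g n (w n)" for n
      using JV[OF s_nonneg] xpos by (simp_all add: w_def g_def)
    obtain y z where y: "disjoint_seq y" "\<And>n. 0 \<le> y n" "\<And>n. y n \<le> w n"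
      and wy: "\<And>n. w n \<le> y n + 4 ^ n *\<^sub>R (\<Sum>k<n. w k) + (1 / 2) ^ n *\<^sub>R z"
      using disjointification[of w] w by blast
    have "(\<lambda>n. x i (y n)) \<longlonglongrightarrow> 0"
    proof (rule null[OF xpos[OF i] y(1,2)])
      show "norm (y n) \<le> 1" for n
        using norm_mono_nonneg[OF y(2,3)] w(2) by (rule order_trans)
    qed
    moreover have "(\<lambda>n. (1 / 2) ^ n * (x i \<bar>z\<bar>)) \<longlonglongrightarrow> 0"
      by (intro tendsto_mult_left_zero LIMSEQ_power_zero) simp
    ultimately have "(\<lambda>n. x i (y n) + l / 8 + (1 / 2) ^ n * (x i \<bar>z\<bar>)) \<longlonglongrightarrow> 0 + l / 8 + 0"
      by (intro tendsto_intros)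
    moreover have "l / 2 \<le> x i (y n) + l / 8 + (1 / 2) ^ n * (x i \<bar>z\<bar>)" for n
    proof -
      have le: "g n v \<le> x i v" if "0 \<le> v" for v
        using g(2)[of n] that by (simp add: less_eq_blinfun_def)
      have "g n (w n) \<le> g n (y n) + 4 ^ n * g n (s n) + (1 / 2) ^ n * g n z"
        using nonneg_blinfun_mono[OF g(1)[of n] wy[of n]]
        by (simp add: blinfun.add_right blinfun.scaleR_right s_sum)
      moreover have "g n z \<le> x i \<bar>z\<bar>"
        using nonneg_blinfun_mono[OF g(1)[of n] abs_ge_self[of z]] le[of "\<bar>z\<bar>"] by simp
      then have "(1 / 2) ^ n * g n z \<le> (1 / 2) ^ n * x i \<bar>z\<bar>"
        by (intro mult_left_mono) simp_all
      ultimately show ?thesis using le[OF y(2)[of n]] g(3,4)[of n] by linarith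
    qed
    ultimately have "l / 2 \<le> 0 + l / 8 + 0"
      by (intro LIMSEQ_le_const) auto
    then show False using \<open>0 < l\<close> by simp
  qed
  moreover have "norm (x j) \<le> norm (x i)" if "(i, j) \<in> r" for i j
    using nonneg_functional_norm_mono[OF xpos mono[OF that]] rI that by auto
  ultimately show "decreases_to_zero I r (\<lambda>i. norm (x i))"
    by (auto simp: decreases_to_zero_def)
qed

lemma rank_one_operator:
  fixes g :: "'e::banach_lattice \<Rightarrow>\<^sub>L real" and y :: "'f::banach_lattice"
  assumes "0 \<le> g" "0 \<le> y"
  obtains T :: "'e \<Rightarrow>\<^sub>L 'f" where "\<And>x. T x = g x *\<^sub>R y" "0 \<le> T" "semi_compact T"
proof -
  have "bounded_linear (\<lambda>x. g x *\<^sub>R y)"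
    using bounded_linear_compose[OF bounded_linear_scaleR_left blinfun.bounded_linear_right] .
  then have T: "blinfun_apply (Blinfun (\<lambda>x. g x *\<^sub>R y)) = (\<lambda>x. g x *\<^sub>R y)"
    by (rule bounded_linear_Blinfun_apply)
  have "semi_compact (Blinfun (\<lambda>x. g x *\<^sub>R y))"
    unfolding semi_compact_def T
  proof (intro allI impI exI conjI)
    fix \<epsilon> :: real
    show u: "0 \<le> norm g *\<^sub>R y" using assms(2) by (simp add: scaleR_nonneg_nonneg)
    show "(\<lambda>x. g x *\<^sub>R y) ` cball 0 1
        \<subseteq> {v + \<epsilon> *\<^sub>R w |v w. v \<in> {- (norm g *\<^sub>R y)..norm g *\<^sub>R y} \<and> w \<in> cball 0 1}"
    proof (rule image_subsetI)
      fix x :: 'e assume "x \<in> cball 0 1"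
      then have "norm g * norm x \<le> norm g" by (simp add: mult_left_le)
      then have "\<bar>g x\<bar> \<le> norm g" using norm_blinfun[of g x] by simp
      then have "g x *\<^sub>R y \<le> norm g *\<^sub>R y" "(- norm g) *\<^sub>R y \<le> g x *\<^sub>R y"
        using assms(2) by (auto intro!: scaleR_right_mono simp del: scaleR_minus_left)
      then show "g x *\<^sub>R y \<in> {v + \<epsilon> *\<^sub>R w |v w. v \<in> {- (norm g *\<^sub>R y)..norm g *\<^sub>R y} \<and> w \<in> cball 0 1}"
        by (intro CollectI exI[of _ "g x *\<^sub>R y"] exI[of _ 0]) simp
    qed
  qed
  then show thesis
    using assms by (intro that[of "Blinfun (\<lambda>x. g x *\<^sub>R y)"])
      (simp_all add: T blinfun_nonneg_iff scaleR_nonneg_nonneg)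
qed

section \<open>From an order continuous dual norm to disjoint sequences\<close>

text \<open>The functional \<open>h\<close> is the component of \<open>g\<close> carried by the band generated by \<open>w\<close>. It is additive
  because \<open>inf a (k *\<^sub>R w) + inf b (k *\<^sub>R w)\<close> lies between \<open>inf (a + b) (k *\<^sub>R w)\<close> and
  \<open>inf (a + b) ((2 * k) *\<^sub>R w)\<close>.\<close>
lemma functional_component:
  fixes g :: "'a::banach_lattice \<Rightarrow>\<^sub>L real"
  assumes g: "0 \<le> g" and w: "0 \<le> w"
  obtains h :: "'a \<Rightarrow>\<^sub>L real" where "0 \<le> h"
    "\<And>v. 0 \<le> v \<Longrightarrow> (\<lambda>k. g (inf v (real k *\<^sub>R w))) \<longlonglongrightarrow> h v"
proof -
  define p where "p v = lim (\<lambda>k. g (inf v (real k *\<^sub>R w)))" for v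
  have kw: "0 \<le> real k *\<^sub>R w" for k using w by (simp add: scaleR_nonneg_nonneg)
  have le: "g (inf v (real k *\<^sub>R w)) \<le> g v" for v k
    by (rule nonneg_blinfun_mono[OF g]) simp
  have nonneg: "0 \<le> g (inf v (real k *\<^sub>R w))" if "0 \<le> v" for v k
    using g that kw by (simp add: blinfun_nonneg_iff)
  have lim: "(\<lambda>k. g (inf v (real k *\<^sub>R w))) \<longlonglongrightarrow> p v" if "0 \<le> v" for v
  proof -
    have "incseq (\<lambda>k. g (inf v (real k *\<^sub>R w)))"
      by (intro monoI nonneg_blinfun_mono[OF g] inf_mono scaleR_right_mono) (simp_all add: w)
    from incseq_convergent[OF this] le show ?thesis
      unfolding p_def by (metis limI)
  qed
  have p_nonneg: "0 \<le> p v" if "0 \<le> v" for v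
    by (rule LIMSEQ_le_const[OF lim[OF that]]) (use nonneg[OF that] in blast)
  have p_le: "p v \<le> g v" if "0 \<le> v" for v
    by (rule LIMSEQ_le_const2[OF lim[OF that]]) (use le in blast)
  have p_add: "p (a + b) = p a + p b" if a: "0 \<le> a" and b: "0 \<le> b" for a b
  proof (rule antisym)
    have ab: "0 \<le> a + b" using a b by simp
    have "inf (a + b) (real k *\<^sub>R w) \<le> inf a (real k *\<^sub>R w) + inf b (real k *\<^sub>R w)" for k
      using inf_add_le[OF kw a b, of k] by (simp add: inf_commute)
    from nonneg_blinfun_mono[OF g this]
    have "g (inf (a + b) (real k *\<^sub>R w)) \<le> g (inf a (real k *\<^sub>R w)) + g (inf b (real k *\<^sub>R w))" for k
      by (simp add: blinfun.add_right)
    then show "p (a + b) \<le> p a + p b"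
      by (intro LIMSEQ_le[OF lim[OF ab] tendsto_add[OF lim[OF a] lim[OF b]]]) blast
    have "inf a (real k *\<^sub>R w) + inf b (real k *\<^sub>R w) \<le> inf (a + b) (real (2 * k) *\<^sub>R w)" for k
    proof -
      have "inf a (real k *\<^sub>R w) + inf b (real k *\<^sub>R w) \<le> a + b"
        by (intro add_mono) simp_all
      moreover have "inf a (real k *\<^sub>R w) + inf b (real k *\<^sub>R w) \<le> real k *\<^sub>R w + real k *\<^sub>R w"
        by (intro add_mono) simp_all
      moreover have "real k *\<^sub>R w + real k *\<^sub>R w = real (2 * k) *\<^sub>R w"
        by (simp flip: scaleR_add_left)
      ultimately show ?thesis by simp
    qed
    from nonneg_blinfun_mono[OF g this]
    have "g (inf a (real k *\<^sub>R w)) + g (inf b (real k *\<^sub>R w)) \<le> g (inf (a + b) (real (2 * k) *\<^sub>R w))" for k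
      by (simp add: blinfun.add_right)
    moreover have "(\<lambda>k. g (inf (a + b) (real (2 * k) *\<^sub>R w))) \<longlonglongrightarrow> p (a + b)"
      using LIMSEQ_subseq_LIMSEQ[OF lim[OF ab], of "\<lambda>k. 2 * k"] by (simp add: strict_mono_def o_def)
    ultimately show "p a + p b \<le> p (a + b)"
      by (intro LIMSEQ_le[OF tendsto_add[OF lim[OF a] lim[OF b]]]) blast+
  qed
  have p_bound: "p v \<le> norm g * norm v" if "0 \<le> v" for v
    using p_le[OF that] norm_blinfun[of g v] by simp
  obtain h :: "'a \<Rightarrow>\<^sub>L real" where "0 \<le> h" "\<And>v. 0 \<le> v \<Longrightarrow> h v = p v"
    using Kantorovich_extension[OF p_nonneg p_add p_bound] by blast
  then show thesis using lim by (intro that[of h]) simp_all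
qed

lemma increasing_functionals_limit:
  fixes H :: "nat \<Rightarrow> 'a::banach_lattice \<Rightarrow>\<^sub>L real"
  assumes nonneg: "\<And>n. 0 \<le> H n" and mono: "\<And>m n. m \<le> n \<Longrightarrow> H m \<le> H n" and le: "\<And>n. H n \<le> g"
  obtains K :: "'a \<Rightarrow>\<^sub>L real" where "\<And>n. H n \<le> K" "\<And>v. 0 \<le> v \<Longrightarrow> (\<lambda>n. H n v) \<longlonglongrightarrow> K v"
proof -
  define p where "p v = lim (\<lambda>n. H n v)" for v
  have lim: "(\<lambda>n. H n v) \<longlonglongrightarrow> p v" and H_le: "H n v \<le> p v" if "0 \<le> v" for v n
  proof -
    have inc: "incseq (\<lambda>n. H n v)"
      using mono that by (intro monoI) (simp add: less_eq_blinfun_def)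
    have "H n v \<le> g v" for n using le that by (simp add: less_eq_blinfun_def)
    from incseq_convergent[OF inc] this show lim: "(\<lambda>n. H n v) \<longlonglongrightarrow> p v"
      unfolding p_def by (metis limI)
    show "H n v \<le> p v" by (rule incseq_le[OF inc lim])
  qed
  have p_nonneg: "0 \<le> p v" if "0 \<le> v" for v
    using H_le[OF that, of 0] nonneg[of 0] that by (auto simp: blinfun_nonneg_iff intro: order_trans)
  have p_add: "p (a + b) = p a + p b" if "0 \<le> a" "0 \<le> b" for a b
  proof -
    have "(\<lambda>n. H n (a + b)) \<longlonglongrightarrow> p a + p b"
      unfolding blinfun.add_right by (intro tendsto_add lim that)
    then show ?thesis
      using lim[of "a + b"] that by (intro LIMSEQ_unique[of "\<lambda>n. H n (a + b)"]) simp_all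
  qed
  have p_bound: "p v \<le> norm g * norm v" if "0 \<le> v" for v
  proof (rule LIMSEQ_le_const2[OF lim[OF that]])
    have "H n v \<le> norm g * norm v" for n
      using le[of n] that norm_blinfun[of g v] by (fastforce simp: less_eq_blinfun_def)
    then show "\<exists>N. \<forall>n\<ge>N. H n v \<le> norm g * norm v" by blast
  qed
  obtain K :: "'a \<Rightarrow>\<^sub>L real" where "0 \<le> K" "\<And>v. 0 \<le> v \<Longrightarrow> K v = p v"
    using Kantorovich_extension[OF p_nonneg p_add p_bound] by blast
  then show thesis
    using lim H_le by (intro that[of K]) (simp_all add: less_eq_blinfun_def)
qed

text \<open>
  Let \<open>H n\<close> be the component of \<open>g\<close> carried by \<open>x 0 + \<dots> + x (n - 1)\<close>. It vanishes at \<open>x n\<close> by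
  disjointness and agrees with \<open>g\<close> at all earlier \<open>x i\<close>. So the limit \<open>K\<close> of the increasing \<open>H n\<close>
  agrees with \<open>g\<close> along the whole sequence, and \<open>g (x n) = (K - H n) (x n) \<le> norm (K - H n)\<close>. Since
  \<open>K - H n\<close> decreases to zero, order continuity makes these norms tend to zero.
\<close>
lemma disjoint_null_of_order_continuous_dual:
  fixes g :: "'e::banach_lattice \<Rightarrow>\<^sub>L real"
  assumes oc: "order_continuous_norm TYPE('e \<Rightarrow>\<^sub>L real)" and g: "0 \<le> g"
    and disj: "disjoint_seq x" and x: "\<And>n. 0 \<le> x n" "\<And>n. norm (x n) \<le> 1"
  shows "(\<lambda>n. g (x n)) \<longlonglongrightarrow> 0"
proof -
  define w where "w n = (\<Sum>i<n. x i)" for n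
  have w: "0 \<le> w n" for n by (simp add: w_def x sum_nonneg)
  have w_mono: "w m \<le> w n" if "m \<le> n" for m n
    unfolding w_def using that x by (intro sum_mono2) auto
  have "\<exists>h :: 'e \<Rightarrow>\<^sub>L real. 0 \<le> h \<and> (\<forall>v\<ge>0. (\<lambda>k. g (inf v (real k *\<^sub>R w n))) \<longlonglongrightarrow> blinfun_apply h v)" for n
    by (rule functional_component[OF g w[of n]]) blast
  then obtain H :: "nat \<Rightarrow> 'e \<Rightarrow>\<^sub>L real" where H: "\<And>n. 0 \<le> H n"
    and H_lim: "\<And>n v. 0 \<le> v \<Longrightarrow> (\<lambda>k. g (inf v (real k *\<^sub>R w n))) \<longlonglongrightarrow> H n v"
    by metis
  have H_mono: "H m \<le> H n" if "m \<le> n" for m n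
    unfolding less_eq_blinfun_def
  proof (intro allI impI)
    fix v :: 'e assume v: "0 \<le> v"
    have "g (inf v (real k *\<^sub>R w m)) \<le> g (inf v (real k *\<^sub>R w n))" for k
      using w_mono[OF that] by (intro nonneg_blinfun_mono[OF g] inf_mono scaleR_left_mono) simp_all
    then show "H m v \<le> H n v"
      by (intro LIMSEQ_le[OF H_lim[OF v] H_lim[OF v]]) blast
  qed
  have H_le: "H n \<le> g" for n
    unfolding less_eq_blinfun_def
  proof (intro allI impI)
    fix v :: 'e assume v: "0 \<le> v"
    have "g (inf v (real k *\<^sub>R w n)) \<le> g v" for k
      by (intro nonneg_blinfun_mono[OF g]) simp
    then show "H n v \<le> g v"
      by (intro LIMSEQ_le_const2[OF H_lim[OF v]]) blast
  qed
  have H_zero: "H n (x n) = 0" for n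
  proof -
    have "inf (x n) (x i) = 0" if "i < n" for i
      using disj that x unfolding disjoint_seq_def by (metis abs_of_nonneg less_irrefl)
    then have "inf (x n) (w n) = 0"
      unfolding w_def by (intro disjoint_sum) (auto simp: x)
    then have "inf (x n) (real k *\<^sub>R w n) = 0" for k
      by (intro disjoint_scaleR x w) simp_all
    then show ?thesis
      using H_lim[OF x(1), of n n] by (simp add: LIMSEQ_const_iff)
  qed
  have H_full: "H n (x i) = g (x i)" if "i < n" for i n
  proof -
    have "x i \<le> w n"
      unfolding w_def using sum_mono2[of "{..<n}" "{i}" x] that x by simp
    moreover have "w n \<le> real (Suc k) *\<^sub>R w n" for k
      using scaleR_right_mono[of 1 "real (Suc k)" "w n"] w by simp
    ultimately have "inf (x i) (real (Suc k) *\<^sub>R w n) = x i" for k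
      by (meson inf_absorb1 order_trans)
    then have "(\<lambda>k. g (inf (x i) (real (Suc k) *\<^sub>R w n))) \<longlonglongrightarrow> g (x i)" by simp
    moreover have "(\<lambda>k. g (inf (x i) (real (Suc k) *\<^sub>R w n))) \<longlonglongrightarrow> H n (x i)"
      by (rule LIMSEQ_Suc[OF H_lim[OF x(1)]])
    ultimately show ?thesis by (rule LIMSEQ_unique[rotated])
  qed
  obtain K :: "'e \<Rightarrow>\<^sub>L real" where K: "\<And>n. H n \<le> K" "\<And>v. 0 \<le> v \<Longrightarrow> (\<lambda>n. H n v) \<longlonglongrightarrow> K v"
  proof (rule increasing_functionals_limit[OF H H_mono H_le])
    fix K :: "'e \<Rightarrow>\<^sub>L real"
    assume "\<And>n. H n \<le> K" "\<And>v. 0 \<le> v \<Longrightarrow> (\<lambda>n. H n v) \<longlonglongrightarrow> K v"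
    then show thesis by (rule that)
  qed
  have K_x: "K (x i) = g (x i)" for i
  proof (rule LIMSEQ_unique[OF K(2)[OF x(1)]])
    have "\<forall>\<^sub>F n in sequentially. g (x i) = H n (x i)"
      using eventually_gt_at_top[of i] by eventually_elim (simp add: H_full)
    then show "(\<lambda>n. H n (x i)) \<longlonglongrightarrow> g (x i)"
      by (rule Lim_transform_eventually[OF tendsto_const])
  qed
  define D where "D n = K - H n" for n
  have D: "0 \<le> D n" for n using K(1) by (simp add: D_def)
  have D_mono: "D n \<le> D m" if "m \<le> n" for m n
    using H_mono[OF that] by (simp add: D_def less_eq_blinfun_def blinfun.diff_left)
  have "directed_set UNIV {(m, n). m \<le> (n :: nat)}"
    by (auto simp: directed_set_def preorder_on_def refl_on_def trans_def intro: exI[of _ "max m n" for m n] max.cobounded1 max.cobounded2)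
  moreover have "decreases_to_zero UNIV {(m, n). m \<le> (n :: nat)} D"
    unfolding decreases_to_zero_def
  proof (intro conjI allI impI)
    fix L :: "'e \<Rightarrow>\<^sub>L real" assume L: "\<forall>i\<in>UNIV. L \<le> D i"
    show "L \<le> 0"
      unfolding less_eq_blinfun_def
    proof (intro allI impI)
      fix v :: 'e assume v: "0 \<le> v"
      have "(\<lambda>n. K v - H n v) \<longlonglongrightarrow> K v - K v"
        by (intro tendsto_intros K(2) v)
      moreover have "L v \<le> K v - H n v" for n
        using L v by (simp add: D_def less_eq_blinfun_def blinfun.diff_left)
      ultimately have "L v \<le> K v - K v"
        by (intro LIMSEQ_le_const) blast+
      then show "L v \<le> blinfun_apply 0 v" by simp
    qed
  qed (use D D_mono in auto)
  ultimately have "decreases_to_zero UNIV {(m, n). m \<le> (n :: nat)} (\<lambda>n. norm (D n))"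
    by (rule order_continuous_norm_net[OF oc])
  then have D_dec: "\<And>m n. m \<le> n \<Longrightarrow> norm (D n) \<le> norm (D m)"
    and D_inf: "\<And>l. (\<And>n. l \<le> norm (D n)) \<Longrightarrow> l \<le> 0"
    by (auto simp: decreases_to_zero_def)
  have D_null: "(\<lambda>n. norm (D n)) \<longlonglongrightarrow> 0"
  proof (rule LIMSEQ_I)
    fix \<epsilon> :: real assume "0 < \<epsilon>"
    then obtain N where "norm (D N) < \<epsilon>" using D_inf[of \<epsilon>] by (meson not_le)
    then have "norm (D n) < \<epsilon>" if "N \<le> n" for n using D_dec[OF that] by simp
    then show "\<exists>N. \<forall>n\<ge>N. norm (norm (D n) - 0) < \<epsilon>" by auto
  qed
  have "norm (g (x n)) \<le> norm (D n)" for n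
  proof -
    have "norm (D n (x n)) \<le> norm (D n) * norm (x n)" by (rule norm_blinfun)
    also have "\<dots> \<le> norm (D n)" using x(2)[of n] by (simp add: mult_left_le)
    finally show ?thesis by (simp add: D_def blinfun.diff_left K_x H_zero)
  qed
  then show ?thesis
    by (intro Lim_null_comparison[OF _ D_null]) simp
qed

section \<open>Weakly null sequences of functionals on order intervals\<close>

text \<open>\<open>join_from z d k\<close> is the supremum of 0 and the \<open>d\<close> elements from \<open>z k\<close> to \<open>z (k + d - 1)\<close>.\<close>
primrec join_from :: "(nat \<Rightarrow> 'a::banach_lattice) \<Rightarrow> nat \<Rightarrow> nat \<Rightarrow> 'a" where
  "join_from z 0 k = 0"
| "join_from z (Suc d) k = sup (z k) (join_from z d (Suc k))"

lemma join_from_nonneg: "(\<And>k. 0 \<le> z k) \<Longrightarrow> 0 \<le> join_from z d k"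
  by (cases d) (simp_all add: le_supI1)

lemma join_from_le: "(\<And>k. z k \<le> u) \<Longrightarrow> 0 \<le> u \<Longrightarrow> join_from z d k \<le> u"
  by (induction d arbitrary: k) simp_all

lemma join_from_Suc_le: "(\<And>k. 0 \<le> z k) \<Longrightarrow> join_from z d k \<le> join_from z (Suc d) k"
proof (induction d arbitrary: k)
  case 0
  then show ?case by (simp add: le_supI1)
next
  case (Suc d)
  show ?case
    using sup_mono[OF order_refl Suc.IH[OF Suc.prems, of "Suc k"], of "z k"] by simp
qed

lemma join_from_le_sum: "(\<And>k. 0 \<le> z k) \<Longrightarrow> join_from z d k \<le> (\<Sum>i<d. z (k + i))"
proof (induction d arbitrary: k)
  case (Suc d)
  have "join_from z d (Suc k) \<le> (\<Sum>i<d. z (Suc k + i))" by (rule Suc.IH[OF Suc.prems])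
  moreover have "0 \<le> (\<Sum>i<d. z (Suc k + i))" using Suc.prems by (simp add: sum_nonneg)
  moreover have "(\<Sum>i<Suc d. z (k + i)) = z k + (\<Sum>i<d. z (Suc k + i))"
    by (subst sum.lessThan_Suc_shift) simp
  ultimately show ?case
    using Suc.prems[of k] by (simp add: add_increasing)
qed simp

text \<open>The difference of two consecutive joins is the part of \<open>z k\<close> that is not covered by the later
  elements.\<close>
lemma join_from_diff: "z k - (join_from z (Suc d) k - join_from z d (Suc k)) = inf (z k) (join_from z d (Suc k))"
  using add_eq_inf_sup[of "z k" "join_from z d (Suc k)"]
  by (simp add: algebra_simps del: diff_sup_eq_inf)

text \<open>The functional \<open>\<sigma>\<close> stands for the supremum of all \<open>z i\<close> with \<open>i \<ge> k\<close>, which need not exist in the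
  lattice but does exist in its bidual. The limit exists for positive \<open>h\<close> by monotonicity, and for
  all others since they are differences of positive ones.\<close>
lemma join_from_functional:
  fixes z :: "nat \<Rightarrow> 'a::banach_lattice"
  assumes z: "\<And>k. 0 \<le> z k" "\<And>k. z k \<le> u"
  obtains \<sigma> :: "('a \<Rightarrow>\<^sub>L real) \<Rightarrow>\<^sub>L real" where "\<And>h. (\<lambda>d. blinfun_apply h (join_from z d k)) \<longlonglongrightarrow> \<sigma> h"
proof -
  define s where "s d = join_from z d k" for d
  have u: "0 \<le> u" using z[of 0] by (rule order_trans)
  have s: "0 \<le> s d" "s d \<le> u" "s d \<le> s (Suc d)" for d
    unfolding s_def using z u join_from_nonneg join_from_le join_from_Suc_le by blast+
  have conv_pos: "convergent (\<lambda>d. h (s d))" if "0 \<le> h" for h :: "'a \<Rightarrow>\<^sub>L real"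
  proof -
    have "incseq (\<lambda>d. h (s d))"
      by (intro incseq_SucI nonneg_blinfun_mono[OF that] s)
    moreover have "\<forall>d. h (s d) \<le> h u" using nonneg_blinfun_mono[OF that s(2)] by blast
    ultimately show ?thesis by (metis incseq_convergent convergentI)
  qed
  have conv: "convergent (\<lambda>d. h (s d))" for h :: "'a \<Rightarrow>\<^sub>L real"
  proof -
    obtain a :: "'a \<Rightarrow>\<^sub>L real" where a: "0 \<le> a" "h \<le> a" using functional_modulus[of h] by blast
    then have "0 \<le> a - h" by simp
    from convergent_diff[OF conv_pos[OF a(1)] conv_pos[OF this]] show ?thesis
      by (simp add: blinfun.diff_left)
  qed
  define L where "L h = lim (\<lambda>d. h (s d))" for h :: "'a \<Rightarrow>\<^sub>L real"
  have L: "(\<lambda>d. h (s d)) \<longlonglongrightarrow> L h" for h :: "'a \<Rightarrow>\<^sub>L real"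
    using conv by (simp add: L_def convergent_LIMSEQ_iff)
  have "bounded_linear L"
  proof (rule bounded_linear_intro)
    fix h h' :: "'a \<Rightarrow>\<^sub>L real" and c :: real
    show "L (h + h') = L h + L h'"
      by (rule LIMSEQ_unique[OF L]) (simp add: blinfun.add_left tendsto_add L)
    show "L (c *\<^sub>R h) = c *\<^sub>R L h"
      by (rule LIMSEQ_unique[OF L]) (simp add: blinfun.scaleR_left tendsto_mult_left L)
    have "norm (h (s d)) \<le> norm h * norm u" for d
      by (rule order_trans[OF norm_blinfun mult_left_mono[OF norm_mono_nonneg[OF s(1,2)] norm_ge_zero]])
    then show "norm (L h) \<le> norm h * norm u"
      by (intro LIMSEQ_le_const2[OF tendsto_norm[OF L]]) blast
  qed
  then show thesis
    using L by (intro that[of "Blinfun L"]) (simp add: bounded_linear_Blinfun_apply s_def)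
qed

text \<open>
  Suppose \<open>\<bar>f n (z n)\<bar> \<ge> \<delta>\<close> infinitely often. Pass to a subsequence along which the modulus of
  each functional is very small at all later elements \<open>z i\<close>; this is possible since \<open>z\<close> is null for positive
  functionals. With \<open>\<sigma> k\<close> as in the preceding lemma, \<open>\<phi> k = \<sigma> k - \<sigma> (Suc k)\<close> represents the part of
  \<open>z k\<close> not covered by the later elements. The \<open>\<phi> k\<close> are positive and telescope to at most \<open>u\<close>, so
  the diagonal lemma gives \<open>\<phi> k (f k) \<longlonglongrightarrow> 0\<close>. But the covered part of \<open>z k\<close> lies below the sum of the
  later elements and hence contributes at most \<open>\<delta> / 2\<close> to \<open>f k (z k)\<close>.
\<close>
lemma weakly_null_on_order_interval:
  fixes f :: "nat \<Rightarrow> 'a::banach_lattice \<Rightarrow>\<^sub>L real" and z :: "nat \<Rightarrow> 'a"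
  assumes null: "\<And>\<Phi> :: ('a \<Rightarrow>\<^sub>L real) \<Rightarrow>\<^sub>L real. (\<lambda>n. \<Phi> (f n)) \<longlonglongrightarrow> 0"
    and z: "\<And>n. 0 \<le> z n" "\<And>n. z n \<le> u"
    and z_null: "\<And>g :: 'a \<Rightarrow>\<^sub>L real. 0 \<le> g \<Longrightarrow> (\<lambda>n. blinfun_apply g (z n)) \<longlonglongrightarrow> 0"
  shows "(\<lambda>n. f n (z n)) \<longlonglongrightarrow> 0"
proof (rule ccontr)
  assume "\<not> ?thesis"
  then obtain \<delta> where "\<delta> > 0" and often: "\<And>N. \<exists>n\<ge>N. \<delta> \<le> \<bar>f n (z n)\<bar>"
    unfolding LIMSEQ_iff by (auto simp: not_less)
  have "\<exists>a :: 'a \<Rightarrow>\<^sub>L real. 0 \<le> a \<and> f n \<le> a \<and> - f n \<le> a" for n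
    using functional_modulus[of "f n"] by blast
  then obtain a :: "nat \<Rightarrow> 'a \<Rightarrow>\<^sub>L real" where a: "\<And>n. 0 \<le> a n" "\<And>n. f n \<le> a n" "\<And>n. - f n \<le> a n"
    by metis
  have f_le_a: "\<bar>f n v\<bar> \<le> a n v" if "0 \<le> v" for n v
    using a(2,3)[of n] that by (auto simp: less_eq_blinfun_def blinfun.minus_left abs_le_iff)
  define P where "P k N n \<longleftrightarrow> (\<forall>j\<le>N. a j (z n) < \<delta> / 4 * (1 / 2) ^ k)" for k N n :: nat
  have step: "\<exists>n>N. \<delta> \<le> \<bar>f n (z n)\<bar> \<and> P k N n" for k N
  proof -
    have "\<forall>\<^sub>F n in sequentially. a j (z n) < \<delta> / 4 * (1 / 2) ^ k" for j
      by (rule order_tendstoD[OF z_null[OF a(1)]]) (use \<open>\<delta> > 0\<close> in simp)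
    then have "\<forall>\<^sub>F n in sequentially. \<forall>j\<in>{..N}. a j (z n) < \<delta> / 4 * (1 / 2) ^ k"
      by (intro eventually_ball_finite) auto
    then obtain M where M: "\<And>n. M \<le> n \<Longrightarrow> P k N n"
      by (auto simp: eventually_sequentially P_def)
    obtain n where "n \<ge> max M (Suc N)" "\<delta> \<le> \<bar>f n (z n)\<bar>" using often by blast
    then show ?thesis using M[of n] by (intro exI[of _ n]) auto
  qed
  obtain r where r: "strict_mono r" "\<And>k. \<delta> \<le> \<bar>f (r k) (z (r k))\<bar>" "\<And>k. P k (r k) (r (Suc k))"
  proof (rule subsequence_choice[of "\<lambda>n. \<delta> \<le> \<bar>f n (z n)\<bar>" P, OF step])
    fix r assume "strict_mono r" "\<And>k. \<delta> \<le> \<bar>f (r k) (z (r k))\<bar>" "\<And>k. P k (r k) (r (Suc k))"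
    then show thesis by (rule that)
  qed
  define z' where "z' k = z (r k)" for k
  define f' where "f' k = f (r k)" for k
  define a' where "a' k = a (r k)" for k
  have z': "0 \<le> z' k" "z' k \<le> u" for k using z by (simp_all add: z'_def)
  have small: "a' k (z' (Suc k + i)) \<le> \<delta> / 4 * (1 / 2) ^ (k + i)" for k i
    using r(1) r(3)[of "k + i"] by (force simp: P_def a'_def z'_def strict_mono_less_eq intro: less_imp_le)
  have "\<exists>\<sigma> :: ('a \<Rightarrow>\<^sub>L real) \<Rightarrow>\<^sub>L real. \<forall>h. (\<lambda>d. blinfun_apply h (join_from z' d k)) \<longlonglongrightarrow> blinfun_apply \<sigma> h" for k
    using join_from_functional[of z' u k] z' by metis
  then obtain \<sigma> :: "nat \<Rightarrow> ('a \<Rightarrow>\<^sub>L real) \<Rightarrow>\<^sub>L real"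
    where \<sigma>: "\<And>k h. (\<lambda>d. blinfun_apply h (join_from z' d k)) \<longlonglongrightarrow> \<sigma> k h"
    by metis
  define \<phi> where "\<phi> k = \<sigma> k - \<sigma> (Suc k)" for k
  have \<phi>: "(\<lambda>d. h (join_from z' (Suc d) k - join_from z' d (Suc k))) \<longlonglongrightarrow> \<phi> k h"
    for k and h :: "'a \<Rightarrow>\<^sub>L real"
    unfolding \<phi>_def blinfun.diff_left blinfun.diff_right by (intro tendsto_diff LIMSEQ_Suc \<sigma>)
  have \<phi>_nonneg: "0 \<le> \<phi> k h" if "0 \<le> h" for k and h :: "'a \<Rightarrow>\<^sub>L real"
  proof (rule LIMSEQ_le_const[OF \<phi>])
    have "0 \<le> h (join_from z' (Suc d) k - join_from z' d (Suc k))" for d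
      using that by (simp add: blinfun_nonneg_iff del: diff_sup_eq_inf)
    then show "\<exists>N. \<forall>d\<ge>N. 0 \<le> h (join_from z' (Suc d) k - join_from z' d (Suc k))" by blast
  qed
  have "(\<lambda>k. \<phi> k (f' k)) \<longlonglongrightarrow> 0"
  proof (rule weakly_null_diagonal)
    fix h :: "'a \<Rightarrow>\<^sub>L real" and N
    obtain b :: "'a \<Rightarrow>\<^sub>L real" where b: "0 \<le> b" "h \<le> b" "- h \<le> b" "norm b \<le> norm h"
      using functional_modulus[of h] by blast
    have "0 \<le> b - h" "0 \<le> b + h"
      using b(2,3) by (simp, metis diff_ge_0_iff_ge diff_minus_eq_add)
    then have "\<bar>\<phi> k h\<bar> \<le> \<phi> k b" for k
      using \<phi>_nonneg[of "b - h" k] \<phi>_nonneg[of "b + h" k]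
      by (simp add: blinfun.diff_right blinfun.add_right abs_le_iff)
    then have "(\<Sum>k<N. \<bar>\<phi> k h\<bar>) \<le> (\<Sum>k<N. \<phi> k b)" by (rule sum_mono)
    also have "\<dots> = \<sigma> 0 b - \<sigma> N b"
      using sum_lessThan_telescope'[of "\<lambda>k. \<sigma> k b" N] by (simp add: \<phi>_def blinfun.diff_left)
    also have "\<dots> \<le> norm u * norm h"
    proof -
      have u: "0 \<le> u" using z[of 0] by (rule order_trans)
      have j: "0 \<le> join_from z' d k" "join_from z' d k \<le> u" for d k
        using z' u join_from_nonneg join_from_le by blast+
      have "0 \<le> \<sigma> N b"
        using b(1) j by (intro LIMSEQ_le_const[OF \<sigma>]) (auto simp: blinfun_nonneg_iff)
      moreover have "\<sigma> 0 b \<le> b u"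
        using nonneg_blinfun_mono[OF b(1) j(2)] by (intro LIMSEQ_le_const2[OF \<sigma>]) blast
      moreover have "b u \<le> norm b * norm u" using norm_blinfun[of b u] by simp
      moreover have "norm b * norm u \<le> norm h * norm u" using b(4) by (simp add: mult_right_mono)
      ultimately show ?thesis by (simp add: mult.commute)
    qed
    finally show "(\<Sum>k<N. \<bar>\<phi> k h\<bar>) \<le> norm u * norm h" .
  next
    fix \<Phi> :: "('a \<Rightarrow>\<^sub>L real) \<Rightarrow>\<^sub>L real"
    from LIMSEQ_subseq_LIMSEQ[OF null[of \<Phi>] r(1)] show "(\<lambda>k. \<Phi> (f' k)) \<longlonglongrightarrow> 0"
      by (simp add: o_def f'_def)
  qed
  then have "(\<lambda>k. \<bar>\<phi> k (f' k)\<bar>) \<longlonglongrightarrow> 0"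
    by (rule tendsto_rabs_zero)
  then have "\<forall>\<^sub>F k in sequentially. \<bar>\<phi> k (f' k)\<bar> < \<delta> / 2"
    by (rule order_tendstoD) (use \<open>\<delta> > 0\<close> in simp)
  then obtain k where k: "\<bar>\<phi> k (f' k)\<bar> < \<delta> / 2"
    using eventually_happens'[OF sequentially_bot] by blast
  have "\<bar>f' k (z' k) - \<phi> k (f' k)\<bar> \<le> \<delta> / 2"
  proof (rule LIMSEQ_le_const2)
    show "(\<lambda>d. \<bar>f' k (z' k) - f' k (join_from z' (Suc d) k - join_from z' d (Suc k))\<bar>)
        \<longlonglongrightarrow> \<bar>f' k (z' k) - \<phi> k (f' k)\<bar>"
      by (intro tendsto_intros \<phi>)
    have "\<bar>f' k (z' k) - f' k (join_from z' (Suc d) k - join_from z' d (Suc k))\<bar> \<le> \<delta> / 2" for d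
    proof -
      have j: "0 \<le> join_from z' d (Suc k)" by (rule join_from_nonneg) (rule z')
      have "\<bar>f' k (z' k) - f' k (join_from z' (Suc d) k - join_from z' d (Suc k))\<bar>
          = \<bar>f' k (inf (z' k) (join_from z' d (Suc k)))\<bar>"
        by (simp only: join_from_diff flip: blinfun.diff_right)
      also have "\<dots> \<le> a' k (inf (z' k) (join_from z' d (Suc k)))"
        unfolding f'_def a'_def by (rule f_le_a) (simp add: j z')
      also have "\<dots> \<le> a' k (\<Sum>i<d. z' (Suc k + i))"
        unfolding a'_def by (intro nonneg_blinfun_mono a order_trans[OF inf_le2] join_from_le_sum z')
      also have "\<dots> = (\<Sum>i<d. a' k (z' (Suc k + i)))" by (rule blinfun.sum_right)
      also have "\<dots> \<le> (\<Sum>i<d. \<delta> / 4 * (1 / 2) ^ (k + i))" by (intro sum_mono small)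
      also have "\<dots> \<le> (\<Sum>i<d. \<delta> / 4 * (1 / 2) ^ i)"
        using \<open>\<delta> > 0\<close> by (intro sum_mono mult_left_mono power_decreasing) simp_all
      also have "\<dots> = \<delta> / 4 * (\<Sum>i<d. (1 / 2) ^ i)" by (simp add: sum_distrib_left)
      also have "\<dots> \<le> \<delta> / 4 * 2"
        using \<open>\<delta> > 0\<close> by (intro mult_left_mono) (simp_all add: geometric_sum)
      finally show ?thesis by simp
    qed
    then show "\<exists>N. \<forall>d\<ge>N. \<bar>f' k (z' k) - f' k (join_from z' (Suc d) k - join_from z' d (Suc k))\<bar> \<le> \<delta> / 2"
      by blast
  qed
  moreover have "\<delta> \<le> \<bar>f' k (z' k)\<bar>" using r(2) by (simp add: f'_def z'_def)
  ultimately show False using k by linarith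
qed

section \<open>Semi-compact operators\<close>

text \<open>If \<open>T x\<close> lies in \<open>{- u..u} + \<epsilon> *\<^sub>R w\<close>, then \<open>T x - u\<close> is at most \<open>\<bar>\<epsilon> *\<^sub>R w\<bar>\<close>.\<close>
lemma semi_compact_truncation:
  fixes T :: "'e::real_normed_vector \<Rightarrow>\<^sub>L 'f::banach_lattice"
  assumes "semi_compact T" "0 < \<epsilon>"
  obtains u where "0 \<le> u" "\<And>x. norm x \<le> 1 \<Longrightarrow> norm (pprt (T x - u)) \<le> \<epsilon>"
proof -
  obtain u where u: "0 \<le> u" "T ` cball 0 1 \<subseteq> {v + \<epsilon> *\<^sub>R w |v w. v \<in> {- u..u} \<and> w \<in> cball 0 1}"
    using assms by (auto simp: semi_compact_def)
  have "norm (pprt (T x - u)) \<le> \<epsilon>" if x: "norm x \<le> 1" for x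
  proof -
    have "T x \<in> {v + \<epsilon> *\<^sub>R w |v w. v \<in> {- u..u} \<and> w \<in> cball 0 1}"
      using u(2) x by (auto simp: image_subset_iff)
    then obtain v w where "T x = v + \<epsilon> *\<^sub>R w" "v \<le> u" "norm w \<le> 1"
      by auto
    then have "T x - u \<le> \<epsilon> *\<^sub>R w" by (simp add: diff_le_eq)
    also have "\<dots> \<le> \<bar>\<epsilon> *\<^sub>R w\<bar>" by (rule abs_ge_self)
    finally have "pprt (T x - u) \<le> \<bar>\<epsilon> *\<^sub>R w\<bar>" by (simp add: pprt_def)
    from norm_mono_nonneg[OF zero_le_pprt this] have "norm (pprt (T x - u)) \<le> \<epsilon> * norm w"
      using assms(2) by simp
    also have "\<dots> \<le> \<epsilon>" using \<open>norm w \<le> 1\<close> assms(2) by (simp add: mult_left_le)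
    finally show ?thesis .
  qed
  with u(1) show thesis by (rule that)
qed

text \<open>Write \<open>T (x n) = inf (T (x n)) u + pprt (T (x n) - u)\<close>: the first part stays in the order interval
  \<open>{0..u}\<close>, and the second has small norm by semi-compactness.\<close>
lemma semi_compact_weakly_null:
  fixes T :: "'e::banach_lattice \<Rightarrow>\<^sub>L 'f::banach_lattice" and f :: "nat \<Rightarrow> 'f \<Rightarrow>\<^sub>L real"
  assumes T: "0 \<le> T" "semi_compact T"
    and x: "\<And>n. 0 \<le> x n" "\<And>n. norm (x n) \<le> 1"
    and x_null: "\<And>g :: 'e \<Rightarrow>\<^sub>L real. 0 \<le> g \<Longrightarrow> (\<lambda>n. blinfun_apply g (x n)) \<longlonglongrightarrow> 0"
    and null: "\<And>\<Phi> :: ('f \<Rightarrow>\<^sub>L real) \<Rightarrow>\<^sub>L real. (\<lambda>n. \<Phi> (f n)) \<longlonglongrightarrow> 0"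
  shows "(\<lambda>n. f n (T (x n))) \<longlonglongrightarrow> 0"
proof (rule LIMSEQ_I)
  fix \<epsilon> :: real assume "0 < \<epsilon>"
  obtain M where M: "0 < M" "\<And>n. norm (f n) \<le> M"
    using weakly_null_functionals_bounded[OF null] by blast
  obtain u where u: "0 \<le> u" "\<And>x. norm x \<le> 1 \<Longrightarrow> norm (pprt (T x - u)) \<le> \<epsilon> / (2 * M)"
    using semi_compact_truncation[OF T(2), of "\<epsilon> / (2 * M)"] \<open>0 < \<epsilon>\<close> M(1) by auto
  have Tx: "0 \<le> T (x n)" for n using T(1) x(1) by (simp add: blinfun_nonneg_iff)
  have "(\<lambda>n. f n (inf (T (x n)) u)) \<longlonglongrightarrow> 0"
  proof (rule weakly_null_on_order_interval[where u = u, OF null])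
    fix g :: "'f \<Rightarrow>\<^sub>L real" assume g: "0 \<le> g"
    have "0 \<le> g o\<^sub>L T" using g T(1) by (simp add: blinfun_nonneg_iff)
    from x_null[OF this] have lim: "(\<lambda>n. g (T (x n))) \<longlonglongrightarrow> 0" by simp
    have "norm (g (inf (T (x n)) u)) \<le> g (T (x n))" for n
      using nonneg_blinfun_mono[OF g, of "inf (T (x n)) u" "T (x n)"] g Tx[of n] u(1)
      by (simp add: blinfun_nonneg_iff)
    then show "(\<lambda>n. g (inf (T (x n)) u)) \<longlonglongrightarrow> 0"
      by (intro Lim_null_comparison[OF _ lim]) simp
  qed (simp_all add: Tx u(1))
  from LIMSEQ_D[OF this, of "\<epsilon> / 2"] \<open>0 < \<epsilon>\<close>
  obtain N where N: "\<And>n. N \<le> n \<Longrightarrow> \<bar>f n (inf (T (x n)) u)\<bar> < \<epsilon> / 2" by auto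
  have "norm (f n (T (x n)) - 0) < \<epsilon>" if "N \<le> n" for n
  proof -
    have "T (x n) = inf (T (x n)) u + pprt (T (x n) - u)"
      using diff_inf_eq_pprt[of "T (x n)" u] by (metis add.commute diff_add_cancel)
    then have "f n (T (x n)) = f n (inf (T (x n)) u) + f n (pprt (T (x n) - u))"
      by (metis blinfun.add_right)
    moreover have "\<bar>f n (pprt (T (x n) - u))\<bar> \<le> M * (\<epsilon> / (2 * M))"
      using norm_blinfun[of "f n" "pprt (T (x n) - u)"] mult_mono[OF M(2) u(2)[OF x(2)], of n n] M(1)
      by simp
    moreover have "M * (\<epsilon> / (2 * M)) = \<epsilon> / 2" using M(1) by simp
    ultimately show ?thesis using N[OF that] by simp
  qed
  then show "\<exists>N. \<forall>n\<ge>N. norm (f n (T (x n)) - 0) < \<epsilon>" by blast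
qed

lemma disjoint_seq_pprt:
  fixes x :: "nat \<Rightarrow> 'a::banach_lattice"
  assumes "disjoint_seq x"
  shows "disjoint_seq (\<lambda>n. pprt (x n))"
  unfolding disjoint_seq_def
proof (intro allI impI)
  fix m n :: nat assume "m \<noteq> n"
  then have "inf \<bar>x m\<bar> \<bar>x n\<bar> = 0" using assms by (simp add: disjoint_seq_def)
  with inf_mono[OF pprt_le_abs[of "x m"] pprt_le_abs[of "x n"]]
  show "inf \<bar>pprt (x m)\<bar> \<bar>pprt (x n)\<bar> = 0"
    by (intro antisym) simp_all
qed

text \<open>Positive and negative parts of a disjoint sequence are again disjoint sequences, so the \<open>x n\<close> may be
  taken to be positive. For the weak limit \<open>l\<close> of the functionals, \<open>l (T (x n))\<close> is
  dominated by a positive functional of \<open>x n\<close>.\<close>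
lemma semi_compact_almost_M_weakly_compact:
  fixes T :: "'e::banach_lattice \<Rightarrow>\<^sub>L 'f::banach_lattice"
  assumes oc: "order_continuous_norm TYPE('e \<Rightarrow>\<^sub>L real)" and T: "0 \<le> T" "semi_compact T"
  shows "almost_M_weakly_compact T"
  unfolding almost_M_weakly_compact_def
proof (intro allI impI)
  fix x :: "nat \<Rightarrow> 'e" and f :: "nat \<Rightarrow> 'f \<Rightarrow>\<^sub>L real"
  assume disj: "disjoint_seq x" and ball: "range x \<subseteq> cball 0 1" and "weakly_convergent f"
  then obtain l where l: "\<And>\<Phi> :: ('f \<Rightarrow>\<^sub>L real) \<Rightarrow>\<^sub>L real. (\<lambda>n. \<Phi> (f n)) \<longlonglongrightarrow> \<Phi> l"
    by (auto simp: weakly_convergent_def)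
  have null: "(\<lambda>n. \<Phi> (f n - l)) \<longlonglongrightarrow> 0" for \<Phi> :: "('f \<Rightarrow>\<^sub>L real) \<Rightarrow>\<^sub>L real"
    using LIM_zero[OF l[of \<Phi>]] by (simp add: blinfun.diff_right)
  have positive_case: "(\<lambda>n. f n (T (y n))) \<longlonglongrightarrow> 0"
    if y: "disjoint_seq y" "\<And>n. 0 \<le> y n" "\<And>n. norm (y n) \<le> 1" for y
  proof -
    have y_null: "(\<lambda>n. blinfun_apply g (y n)) \<longlonglongrightarrow> 0" if "0 \<le> g" for g :: "'e \<Rightarrow>\<^sub>L real"
      by (rule disjoint_null_of_order_continuous_dual[OF oc that y])
    obtain a :: "'f \<Rightarrow>\<^sub>L real" where a: "0 \<le> a" "l \<le> a" "- l \<le> a"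
      using functional_modulus[of l] by blast
    have "0 \<le> a o\<^sub>L T" using a(1) T(1) by (simp add: blinfun_nonneg_iff)
    from y_null[OF this] have lim: "(\<lambda>n. a (T (y n))) \<longlonglongrightarrow> 0" by simp
    have "norm (l (T (y n))) \<le> a (T (y n))" for n
      using a(2,3) T(1) y(2)[of n]
      by (auto simp: less_eq_blinfun_def blinfun.minus_left abs_le_iff)
    then have "(\<lambda>n. l (T (y n))) \<longlonglongrightarrow> 0"
      by (intro Lim_null_comparison[OF _ lim]) simp
    moreover have "(\<lambda>n. (f n - l) (T (y n))) \<longlonglongrightarrow> 0"
      by (rule semi_compact_weakly_null[OF T y(2,3) y_null null])
    ultimately have "(\<lambda>n. (f n - l) (T (y n)) + l (T (y n))) \<longlonglongrightarrow> 0 + 0"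
      by (intro tendsto_add)
    then show ?thesis by (simp add: blinfun.diff_left)
  qed
  have x: "norm (x n) \<le> 1" for n using ball by (auto simp: image_subset_iff)
  have "(\<lambda>n. f n (T (pprt (x n)))) \<longlonglongrightarrow> 0"
    by (rule positive_case) (simp_all add: disj disjoint_seq_pprt order_trans[OF norm_pprt_le x])
  moreover have "(\<lambda>n. f n (T (pprt (- x n)))) \<longlonglongrightarrow> 0"
  proof (rule positive_case)
    have "disjoint_seq (\<lambda>n. - x n)" using disj by (simp add: disjoint_seq_def)
    then show "disjoint_seq (\<lambda>n. pprt (- x n))" by (rule disjoint_seq_pprt)
    show "norm (pprt (- x n)) \<le> 1" for n
      using norm_pprt_le[of "- x n"] x[of n] by simp
  qed (rule zero_le_pprt)
  ultimately have "(\<lambda>n. f n (T (pprt (x n) - pprt (- x n)))) \<longlonglongrightarrow> 0"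
    using tendsto_diff by (fastforce simp: blinfun.diff_right)
  then show "(\<lambda>n. f n (T (x n))) \<longlonglongrightarrow> 0"
    by (simp only: pprt_minus_pprt)
qed

theorem theorem2p2:
  assumes "\<exists>x::'e::banach_lattice. x \<noteq> 0"
    and "\<exists>y::'f::banach_lattice. y \<noteq> 0"
  shows "(\<forall>T :: 'e \<Rightarrow>\<^sub>L 'f. 0 \<le> T \<longrightarrow> semi_compact T \<longrightarrow> almost_M_weakly_compact T)
    \<longleftrightarrow> order_continuous_norm TYPE('e \<Rightarrow>\<^sub>L real)"
proof
  assume all: "\<forall>T :: 'e \<Rightarrow>\<^sub>L 'f. 0 \<le> T \<longrightarrow> semi_compact T \<longrightarrow> almost_M_weakly_compact T"
  obtain y0 :: 'f where "y0 \<noteq> 0" using assms(2) by blast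
  define v where "v = \<bar>y0\<bar>"
  have v: "0 \<le> v" "0 < norm v" using \<open>y0 \<noteq> 0\<close> by (simp_all add: v_def)
  obtain f :: "'f \<Rightarrow>\<^sub>L real" where "norm v \<le> f v" by (rule norming_functional)
  with v(2) have fv: "0 < f v" by linarith
  show "order_continuous_norm TYPE('e \<Rightarrow>\<^sub>L real)"
  proof (rule order_continuous_dual_normI)
    fix g :: "'e \<Rightarrow>\<^sub>L real" and x :: "nat \<Rightarrow> 'e"
    assume g: "0 \<le> g" and x: "disjoint_seq x" "\<And>n. norm (x n) \<le> 1"
    obtain T :: "'e \<Rightarrow>\<^sub>L 'f" where T: "\<And>x. T x = g x *\<^sub>R v" "0 \<le> T" "semi_compact T"
      using rank_one_operator[OF g v(1)] by blast
    have "almost_M_weakly_compact T" using all T(2,3) by blast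
    moreover have "range x \<subseteq> cball 0 1" using x(2) by (auto simp: image_subset_iff)
    moreover have "weakly_convergent (\<lambda>n :: nat. f)"
      unfolding weakly_convergent_def by (intro exI[of _ f] allI tendsto_const)
    ultimately have "(\<lambda>n. f (T (x n))) \<longlonglongrightarrow> 0"
      using x(1) unfolding almost_M_weakly_compact_def by blast
    then have "(\<lambda>n. g (x n) * f v) \<longlonglongrightarrow> 0"
      by (simp add: T(1) blinfun.scaleR_right)
    from tendsto_divide[OF this tendsto_const[of "f v"]] show "(\<lambda>n. g (x n)) \<longlonglongrightarrow> 0"
      using fv by simp
  qed
next
  assume "order_continuous_norm TYPE('e \<Rightarrow>\<^sub>L real)"
  then show "\<forall>T :: 'e \<Rightarrow>\<^sub>L 'f. 0 \<le> T \<longrightarrow> semi_compact T \<longrightarrow> almost_M_weakly_compact T"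
    by (blast intro: semi_compact_almost_M_weakly_compact)
qed

end
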